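(* Assume $\mathcal{D}\cap\mathcal{T}=\emptyset$, $\mathcal{D}\cap\mathcal{B}=\emptyset$ and $\mathcal{T}\cap\mathcal{C}=\emptyset$. Let $\mathcal{B}$ and $\mathcal{C}$ be such that $(\mathcal{S}^\circ(\mathcal{C}),\mathcal{Z}^\circ(\mathcal{B}))$ is a $(C,A,B)$-pair of node sets. If $\mathcal{C}=\partial_-(\mathcal{S}^\circ(\mathcal{C}),A)$ and $\mathcal{B}=\partial_+(\mathcal{Z}^\circ(\mathcal{B}),A)$, then the reduced-order compensator $(PKP^\top,PL,MP^\top,G)$ of order $|\mathcal{Z}^\circ|-|\mathcal{S}^\circ|$ solving the DDPDF is uniquely defined by $$\begin{cases}K=A-BB^\top A-AC^\top C+BB^\top AC^\top C-K_q,\\ L=AC^\top-BB^\top AC^\top+H_q,\\ M=B^\top A-B^\top AC^\top C+F_q,\\ G=B^\top AC^\top,\end{cases}$$ where $K_q=BF_q+H_qC$, $F_q=N_1(Z^\perp)^\top$ and $H_q=SN_2$ with $N_1,N_2$ arbitrary real matrices of appropriate sizes.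
   Context: Let $(\mathcal{V},\mathcal{E},A)$ be a digraph with $\mathcal{V}=\{v_1,\dots,v_n\}$, where $(v_i,v_j)\in\mathcal{E}$ means $v_i\to v_j$, and $A\in\mathbb{R}^{n\times n}$ has $A_{ji}\ne0$ if and only if $(v_i,v_j)\in\mathcal{E}$. $\mathcal{B},\mathcal{C},\mathcal{D},\mathcal{T}\subseteq\mathcal{V}$ are the sets of input, output, disturbance and target nodes of the system $\dot x=Ax+Bu+Dw$, $y=Cx$, $z=Tx$. The columns of $B$ (resp. $D$) are the canonical vectors $e_i$ with $v_i\in\mathcal{B}$ (resp. $\mathcal{D}$); the rows of $C$ (resp. $T$) are the $e_i^\top$ with $v_i\in\mathcal{C}$ (resp. $\mathcal{T}$). A node set is identified with the subspace of $\mathbb{R}^n$ spanned by the corresponding canonical vectors; its basis matrix has these vectors as columns. $S$ is the basis matrix of $\mathcal{S}^\circ=\mathcal{S}^\circ(\mathcal{C})$ and $Z^\perp$ that of $\mathcal{V}\setminus\mathcal{Z}^\circ$, $\mathcal{Z}^\circ=\mathcal{Z}^\circ(\mathcal{B})$. $\mathcal{Z}$ is $(A,B)$-invariant if $A\mathcal{Z}\subseteq\mathcal{Z}+\mathcal{B}$; $\mathcal{S}$ is $(C,A)$-invariant if $A(\mathcal{S}\setminus\mathcal{C})\subseteq\mathcal{S}$; $(\mathcal{S},\mathcal{Z})$ is a $(C,A,B)$-pair of node sets if $\mathcal{S}\subseteq\mathcal{Z}$, $\mathcal{S}$ is $(C,A)$-invariant and $\mathcal{Z}$ is $(A,B)$-invariant.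 $\mathcal{Z}^\circ(\mathcal{B})$ is the maximal $(A,B)$-invariant node set contained in $\mathcal{V}\setminus\mathcal{T}$, i.e. the (stationary) limit of $\mathcal{Z}_0=\mathcal{V}\setminus\mathcal{T}$, $\mathcal{Z}_{k+1}=\mathcal{Z}_k\setminus\{v_i\in\mathcal{Z}_k:\exists\,(v_i,v_j)\in\mathcal{E},\ v_j\notin\mathcal{Z}_k\cup\mathcal{B}\}$. $\mathcal{S}^\circ(\mathcal{C})$ is the minimal $(C,A)$-invariant node set containing $\mathcal{D}$, i.e. the (stationary) limit of $\mathcal{S}_0=\mathcal{D}$, $\mathcal{S}_{k+1}=\mathcal{S}_k\cup\{v_j\notin\mathcal{S}_k:\exists\,(v_i,v_j)\in\mathcal{E},\ v_i\in\mathcal{S}_k\setminus\mathcal{C}\}$. In-boundary: $\partial_-(\mathcal{W},A)=\{v_i\in\mathcal{W}:\exists\,(v_i,v_j)\in\mathcal{E},\ v_j\notin\mathcal{W}\}$. Out-boundary: $\partial_+(\mathcal{W},A)=\{v_j\notin\mathcal{W}:\exists\,(v_i,v_j)\in\mathcal{E},\ v_i\in\mathcal{W}\}$. Compensators. Given a $(C,A,B)$-pair $(\mathcal{S},\mathcal{Z})$, a full-order compensator $(K,L,M,G)$ is obtained by choosing $G$ with $(A-BGC)\mathcal{S}\subseteq\mathcal{Z}$, $F$ with $(A-BF)\mathcal{Z}\subseteq\mathcal{Z}$, $H$ with $(A-HC)\mathcal{S}\subseteq\mathcal{S}$, and setting $K=A-BF-HC+BGC$, $L=H-BG$, $M=F-GC$.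 Let $P$ be the $(|\mathcal{Z}|-|\mathcal{S}|)\times n$ matrix whose rows are the $e_i^\top$ with $v_i\in\mathcal{Z}\setminus\mathcal{S}$. The corresponding reduced-order compensator, of order $|\mathcal{Z}|-|\mathcal{S}|$, is $(PKP^\top,PL,MP^\top,G)$, i.e. $\dot{\hat x}_r=PKP^\top\hat x_r+PLy$, $u=-MP^\top\hat x_r-Gy$. In the theorem the pair is $(\mathcal{S}^\circ(\mathcal{C}),\mathcal{Z}^\circ(\mathcal{B}))$, and uniqueness refers to the compensators obtained by this construction. A compensator $\dot{\hat x}=\tilde K\hat x+\tilde Ly$, $u=-\tilde M\hat x-\tilde Gy$ solves the DDPDF if, with $A_c=\begin{bmatrix}A-B\tilde GC&-B\tilde M\\ \tilde LC&\tilde K\end{bmatrix}$, $D_c=\begin{bmatrix}D\\0\end{bmatrix}$, $T_c=\begin{bmatrix}T&0\end{bmatrix}$, one has $T_c(sI-A_c)^{-1}D_c=0$ for all $s$ (as a rational matrix identity). *)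

theory Defs
  imports
    "HOL-Computational_Algebra.Polynomial_Factorial"
    "Jordan_Normal_Form.Char_Poly"
    "Jordan_Normal_Form.Gauss_Jordan_Elimination"
    "Jordan_Normal_Form.VS_Connect"
begin

section \<open>Node sets as coordinate subspaces\<close>

text \<open>The nodes v_1, ..., v_n are represented by 0, ..., n - 1, matching the zero-based indices of
  matrices and vectors. The columns of a basis matrix are listed in increasing order of the nodes.\<close>

definition weighted_digraph :: "nat \<Rightarrow> (nat \<times> nat) set \<Rightarrow> real mat \<Rightarrow> bool" where
  "weighted_digraph n E A \<longleftrightarrow> E \<subseteq> {..<n} \<times> {..<n} \<and> A \<in> carrier_mat n n \<and>
     (\<forall>i<n. \<forall>j<n. A $$ (j, i) \<noteq> 0 \<longleftrightarrow> (i, j) \<in> E)"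

definition basis_mat :: "nat \<Rightarrow> nat set \<Rightarrow> real mat" where
  "basis_mat n W = mat_of_cols n (map (unit_vec n) (sorted_list_of_set W))"

definition node_space :: "nat \<Rightarrow> nat set \<Rightarrow> real vec set" where
  "node_space n W =
     LinearCombinations.module.span class_ring (module_vec TYPE(real) n) (unit_vec n ` W)"

lemma basis_mat_carrier [simp]: "basis_mat n W \<in> carrier_mat n (card W)"
  unfolding basis_mat_def by (metis length_map length_sorted_list_of_set mat_of_cols_carrier(1))

lemma node_space_iff:
  assumes W: "W \<subseteq> {..<n}"
  shows "x \<in> node_space n W \<longleftrightarrow> x \<in> carrier_vec n \<and> (\<forall>i<n. i \<notin> W \<longrightarrow> x $ i = 0)"
proof -
  interpret vec_space "TYPE(real)" n .
  let ?U = "unit_vec n ` W :: real vec set"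
  have fin: "finite ?U" using W finite_subset by blast
  have U: "?U \<subseteq> carrier_vec n" by auto
  have inj: "inj_on (unit_vec n :: nat \<Rightarrow> real vec) W"
  proof (rule inj_onI)
    fix i j assume "i \<in> W" "j \<in> W" and eq: "unit_vec n i = (unit_vec n j :: real vec)"
    then have "i < n" "j < n" using W by auto
    then show "i = j" using arg_cong[OF eq, of "\<lambda>v. v $ i"] by (auto split: if_splits)
  qed
  have lc: "lincomb a ?U $ i = (if i \<in> W then a (unit_vec n i) else 0)" if i: "i < n" for a i
  proof -
    have "lincomb a ?U $ i = (\<Sum>x\<in>?U. a x * x $ i)" by (rule lincomb_index[OF i U])
    also have "\<dots> = (\<Sum>j\<in>W. a (unit_vec n j) * unit_vec n j $ i)"
      by (simp add: sum.reindex[OF inj])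
    also have "\<dots> = (\<Sum>j\<in>W. if j = i then a (unit_vec n i) else 0)"
      using W i by (intro sum.cong) (auto simp: unit_vec_def)
    also have "\<dots> = (if i \<in> W then a (unit_vec n i) else 0)"
      using W finite_subset[OF W] by simp
    finally show ?thesis .
  qed
  have sp: "node_space n W = {lincomb a ?U | a. True}"
    unfolding node_space_def using finite_span[OF fin U] by auto
  show ?thesis
  proof
    assume "x \<in> node_space n W"
    then obtain a where x: "x = lincomb a ?U" unfolding sp by auto
    have "x \<in> carrier_vec n" unfolding x using U lincomb_dim[OF fin U] by (intro carrier_vecI) auto
    then show "x \<in> carrier_vec n \<and> (\<forall>i<n. i \<notin> W \<longrightarrow> x $ i = 0)" using lc x by auto
  next
    assume x: "x \<in> carrier_vec n \<and> (\<forall>i<n. i \<notin> W \<longrightarrow> x $ i = 0)"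
    define a :: "real vec \<Rightarrow> real" where "a u = x $ (THE i. i \<in> W \<and> u = unit_vec n i)" for u
    have a: "a (unit_vec n i) = x $ i" if "i \<in> W" for i
    proof -
      have "(THE j. j \<in> W \<and> unit_vec n i = (unit_vec n j :: real vec)) = i"
        using that inj by (intro the_equality) (auto dest: inj_onD)
      then show ?thesis unfolding a_def by simp
    qed
    have "x = lincomb a ?U"
      using x lincomb_dim[OF fin U] lc a by (intro eq_vecI) auto
    then show "x \<in> node_space n W" unfolding sp by auto
  qed
qed

section \<open>Invariant node sets\<close>

definition AB_invariant :: "nat \<Rightarrow> real mat \<Rightarrow> nat set \<Rightarrow> nat set \<Rightarrow> bool" where
  "AB_invariant n A B Z \<longleftrightarrow>
     (\<forall>x\<in>node_space n Z. \<exists>z\<in>node_space n Z. \<exists>b\<in>node_space n B. A *\<^sub>v x = z + b)"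

definition CA_invariant :: "nat \<Rightarrow> nat set \<Rightarrow> real mat \<Rightarrow> nat set \<Rightarrow> bool" where
  "CA_invariant n C A S \<longleftrightarrow> (\<forall>x\<in>node_space n (S - C). A *\<^sub>v x \<in> node_space n S)"

definition CAB_pair :: "nat \<Rightarrow> nat set \<Rightarrow> real mat \<Rightarrow> nat set \<Rightarrow> nat set \<Rightarrow> nat set \<Rightarrow> bool" where
  "CAB_pair n C A B S Z \<longleftrightarrow>
     S \<subseteq> {..<n} \<and> Z \<subseteq> {..<n} \<and> S \<subseteq> Z \<and> CA_invariant n C A S \<and> AB_invariant n A B Z"

definition in_boundary :: "(nat \<times> nat) set \<Rightarrow> nat set \<Rightarrow> nat set" where
  "in_boundary E W = {i \<in> W. \<exists>j. (i, j) \<in> E \<and> j \<notin> W}"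

definition out_boundary :: "(nat \<times> nat) set \<Rightarrow> nat set \<Rightarrow> nat set" where
  "out_boundary E W = {j. j \<notin> W \<and> (\<exists>i. (i, j) \<in> E \<and> i \<in> W)}"

fun Z_seq :: "nat \<Rightarrow> (nat \<times> nat) set \<Rightarrow> nat set \<Rightarrow> nat set \<Rightarrow> nat \<Rightarrow> nat set" where
  "Z_seq n E T B 0 = {..<n} - T"
| "Z_seq n E T B (Suc k) =
     Z_seq n E T B k - {i \<in> Z_seq n E T B k. \<exists>j. (i, j) \<in> E \<and> j \<notin> Z_seq n E T B k \<union> B}"

fun S_seq :: "(nat \<times> nat) set \<Rightarrow> nat set \<Rightarrow> nat set \<Rightarrow> nat \<Rightarrow> nat set" where
  "S_seq E D C 0 = D"
| "S_seq E D C (Suc k) =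
     S_seq E D C k \<union> {j. j \<notin> S_seq E D C k \<and> (\<exists>i. (i, j) \<in> E \<and> i \<in> S_seq E D C k - C)}"

text \<open>The limit of a decreasing (increasing) sequence of sets is its intersection (union).\<close>

definition Z_circ :: "nat \<Rightarrow> (nat \<times> nat) set \<Rightarrow> nat set \<Rightarrow> nat set \<Rightarrow> nat set" where
  "Z_circ n E T B = (\<Inter>k. Z_seq n E T B k)"

definition S_circ :: "(nat \<times> nat) set \<Rightarrow> nat set \<Rightarrow> nat set \<Rightarrow> nat set" where
  "S_circ E D C = (\<Union>k. S_seq E D C k)"

lemma mult_node_space:
  assumes dg: "weighted_digraph n E A" and W: "W \<subseteq> {..<n}" and x: "x \<in> node_space n W"
    and j: "j < n" and no: "\<And>i. i \<in> W \<Longrightarrow> (i, j) \<notin> E"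
  shows "(A *\<^sub>v x) $ j = 0"
proof -
  have A: "A \<in> carrier_mat n n" using dg by (simp add: weighted_digraph_def)
  have xc: "x \<in> carrier_vec n" and x0: "\<And>i. i < n \<Longrightarrow> i \<notin> W \<Longrightarrow> x $ i = 0"
    using x node_space_iff[OF W] by auto
  have "(A *\<^sub>v x) $ j = (\<Sum>i = 0..<n. A $$ (j, i) * x $ i)"
    using A xc j by (auto simp: scalar_prod_def intro!: sum.cong)
  also have "\<dots> = 0"
  proof (rule sum.neutral, intro ballI)
    fix i assume "i \<in> {0..<n}"
    then have i: "i < n" by simp
    show "A $$ (j, i) * x $ i = 0"
      using dg i j no[of i] x0[OF i] by (cases "i \<in> W") (auto simp: weighted_digraph_def)
  qed
  finally show ?thesis .
qed

lemma mult_unit_vec: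
  assumes "A \<in> carrier_mat n n" "i < n" "j < n"
  shows "(A *\<^sub>v unit_vec n i) $ j = (A $$ (j, i) :: real)"
  using assms by simp

lemma unit_vec_node_space: "W \<subseteq> {..<n} \<Longrightarrow> i \<in> W \<Longrightarrow> unit_vec n i \<in> node_space n W"
  by (auto simp: node_space_iff)

lemma AB_invariant_iff:
  assumes dg: "weighted_digraph n E A" and B: "B \<subseteq> {..<n}" and Z: "Z \<subseteq> {..<n}"
  shows "AB_invariant n A B Z \<longleftrightarrow> (\<forall>(i, j)\<in>E. i \<in> Z \<longrightarrow> j \<in> Z \<union> B)"
proof
  assume inv: "AB_invariant n A B Z"
  show "\<forall>(i, j)\<in>E. i \<in> Z \<longrightarrow> j \<in> Z \<union> B"
  proof (clarify, rule ccontr)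
    fix i j assume e: "(i, j) \<in> E" and i: "i \<in> Z" and "j \<notin> B" "j \<notin> Z"
    then have ij: "i < n" "j < n" using dg by (auto simp: weighted_digraph_def)
    obtain z b where zb: "z \<in> node_space n Z" "b \<in> node_space n B" "A *\<^sub>v unit_vec n i = z + b"
      using inv unit_vec_node_space[OF Z i] unfolding AB_invariant_def by blast
    then have "(A *\<^sub>v unit_vec n i) $ j = 0"
      using \<open>j \<notin> B\<close> \<open>j \<notin> Z\<close> ij(2) node_space_iff[OF Z] node_space_iff[OF B] by auto
    moreover have "(A *\<^sub>v unit_vec n i) $ j \<noteq> 0"
      using dg e ij mult_unit_vec[of A n i j] by (auto simp: weighted_digraph_def)
    ultimately show False by simp
  qed
next
  assume edge: "\<forall>(i, j)\<in>E. i \<in> Z \<longrightarrow> j \<in> Z \<union> B"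
  show "AB_invariant n A B Z"
    unfolding AB_invariant_def
  proof
    fix x assume x: "x \<in> node_space n Z"
    let ?y = "A *\<^sub>v x"
    let ?z = "vec n (\<lambda>j. if j \<in> Z then ?y $ j else 0)"
    let ?b = "vec n (\<lambda>j. if j \<in> Z then 0 else ?y $ j)"
    have z: "?z \<in> node_space n Z" using node_space_iff[OF Z] by auto
    have "?y $ j = 0" if "j < n" "j \<notin> Z" "j \<notin> B" for j
      using that edge by (intro mult_node_space[OF dg Z x]) auto
    then have b: "?b \<in> node_space n B" using node_space_iff[OF B] by auto
    have "?y = ?z + ?b" using dg by (intro eq_vecI) (auto simp: weighted_digraph_def)
    then show "\<exists>z\<in>node_space n Z. \<exists>b\<in>node_space n B. ?y = z + b" using z b by blast
  qed
qed

lemma CA_invariant_iff: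
  assumes dg: "weighted_digraph n E A" and S: "S \<subseteq> {..<n}"
  shows "CA_invariant n C A S \<longleftrightarrow> (\<forall>(i, j)\<in>E. i \<in> S - C \<longrightarrow> j \<in> S)"
proof
  have SC: "S - C \<subseteq> {..<n}" using S by blast
  assume inv: "CA_invariant n C A S"
  show "\<forall>(i, j)\<in>E. i \<in> S - C \<longrightarrow> j \<in> S"
  proof (intro ballI, clarify, rule ccontr)
    fix i j assume e: "(i, j) \<in> E" and i: "i \<in> S" "i \<notin> C" and j: "j \<notin> S"
    then have ij: "i < n" "j < n" using dg by (auto simp: weighted_digraph_def)
    have "A *\<^sub>v unit_vec n i \<in> node_space n S"
      using inv unit_vec_node_space[OF SC, of i] i unfolding CA_invariant_def by blast
    then have "(A *\<^sub>v unit_vec n i) $ j = 0" using j ij(2) node_space_iff[OF S] by auto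
    moreover have "(A *\<^sub>v unit_vec n i) $ j \<noteq> 0"
      using dg e ij mult_unit_vec[of A n i j] by (auto simp: weighted_digraph_def)
    ultimately show False by simp
  qed
next
  have SC: "S - C \<subseteq> {..<n}" using S by blast
  assume edge: "\<forall>(i, j)\<in>E. i \<in> S - C \<longrightarrow> j \<in> S"
  show "CA_invariant n C A S"
    unfolding CA_invariant_def
  proof
    fix x assume x: "x \<in> node_space n (S - C)"
    have "(A *\<^sub>v x) $ j = 0" if "j < n" "j \<notin> S" for j
      using that edge by (intro mult_node_space[OF dg SC x]) auto
    moreover have "A *\<^sub>v x \<in> carrier_vec n"
      using dg x node_space_iff[OF SC] by (auto simp: weighted_digraph_def)
    ultimately show "A *\<^sub>v x \<in> node_space n S" using node_space_iff[OF S] by auto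
  qed
qed

lemma Z_seq_decseq: "decseq (Z_seq n E T B)"
  by (rule decseq_SucI) auto

lemma S_seq_incseq: "incseq (S_seq E D C)"
  by (rule incseq_SucI) auto

lemma Z_seq_stationary: "\<exists>m. \<forall>k\<ge>m. Z_seq n E T B k = Z_circ n E T B"
proof -
  let ?Z = "Z_seq n E T B"
  have fin: "finite (?Z k)" for k
    using decseqD[OF Z_seq_decseq, of 0 k] by (rule finite_subset) auto
  define m where "m = (ARG_MIN (\<lambda>k. card (?Z k)) k. True)"
  have min: "card (?Z m) \<le> card (?Z k)" for k
    unfolding m_def by (rule arg_min_nat_le) simp
  have st: "?Z k = ?Z m" if "m \<le> k" for k
    using decseqD[OF Z_seq_decseq that] fin min by (metis card_seteq)
  have "?Z m \<subseteq> ?Z k" for k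
    using st[of k] decseqD[OF Z_seq_decseq, of k m] by (cases "m \<le> k") auto
  then have "Z_circ n E T B = ?Z m" unfolding Z_circ_def by blast
  then show ?thesis using st by blast
qed

lemma S_seq_subset:
  assumes "E \<subseteq> {..<n} \<times> {..<n}" "D \<subseteq> {..<n}"
  shows "S_seq E D C k \<subseteq> {..<n}"
  using assms by (induction k) auto

lemma S_seq_stationary:
  assumes "E \<subseteq> {..<n} \<times> {..<n}" "D \<subseteq> {..<n}"
  shows "\<exists>m. \<forall>k\<ge>m. S_seq E D C k = S_circ E D C"
proof -
  have "finite (S_circ E D C)"
    unfolding S_circ_def using S_seq_subset[OF assms] by (auto intro: finite_subset)
  moreover have "S_circ E D C \<subseteq> \<Union> (range (S_seq E D C))" unfolding S_circ_def by simp
  moreover have "subset.chain UNIV (range (S_seq E D C))"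
    unfolding subset_chain_def using incseqD[OF S_seq_incseq[of E D C]] nat_le_linear
    by (metis subset_UNIV rangeE)
  moreover have "range (S_seq E D C) \<noteq> {}" by simp
  ultimately obtain X where "X \<in> range (S_seq E D C)" "S_circ E D C \<subseteq> X"
    using finite_subset_Union_chain by metis
  then obtain m where m: "S_circ E D C \<subseteq> S_seq E D C m" by blast
  have "S_seq E D C k = S_circ E D C" if "m \<le> k" for k
    using m incseqD[OF S_seq_incseq that, of E D C] unfolding S_circ_def by blast
  then show ?thesis by blast
qed

lemma Z_circ_greatest:
  assumes dg: "weighted_digraph n E A" and B: "B \<subseteq> {..<n}"
  shows "Z_circ n E T B \<subseteq> {..<n} - T" "AB_invariant n A B (Z_circ n E T B)"
    and "\<lbrakk>W \<subseteq> {..<n} - T; AB_invariant n A B W\<rbrakk> \<Longrightarrow> W \<subseteq> Z_circ n E T B"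
proof -
  show sub: "Z_circ n E T B \<subseteq> {..<n} - T"
    unfolding Z_circ_def using Z_seq.simps(1)[of n E T B] by blast
  obtain m where m: "\<forall>k\<ge>m. Z_seq n E T B k = Z_circ n E T B" using Z_seq_stationary by blast
  then have Zm: "Z_seq n E T B m = Z_circ n E T B" and Zs: "Z_seq n E T B (Suc m) = Z_circ n E T B"
    by (blast, metis le_SucI order_refl)
  have "\<forall>(i, j)\<in>E. i \<in> Z_circ n E T B \<longrightarrow> j \<in> Z_circ n E T B \<union> B"
    using Zs unfolding Z_seq.simps(2) Zm by blast
  then show "AB_invariant n A B (Z_circ n E T B)"
    using AB_invariant_iff[OF dg B] sub by blast
  show "W \<subseteq> Z_circ n E T B" if W: "W \<subseteq> {..<n} - T" and inv: "AB_invariant n A B W"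
  proof -
    have edge: "\<forall>(i, j)\<in>E. i \<in> W \<longrightarrow> j \<in> W \<union> B" using AB_invariant_iff[OF dg B] W inv by blast
    have "W \<subseteq> Z_seq n E T B k" for k
      using W edge by (induction k) auto
    then show ?thesis unfolding Z_circ_def by blast
  qed
qed

lemma S_circ_least:
  assumes dg: "weighted_digraph n E A" and D: "D \<subseteq> {..<n}"
  shows "D \<subseteq> S_circ E D C" "S_circ E D C \<subseteq> {..<n}" "CA_invariant n C A (S_circ E D C)"
    and "\<lbrakk>D \<subseteq> W; W \<subseteq> {..<n}; CA_invariant n C A W\<rbrakk> \<Longrightarrow> S_circ E D C \<subseteq> W"
proof -
  have E: "E \<subseteq> {..<n} \<times> {..<n}" using dg by (simp add: weighted_digraph_def)
  show "D \<subseteq> S_circ E D C" unfolding S_circ_def using S_seq.simps(1)[of E D C] by blast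
  show sub: "S_circ E D C \<subseteq> {..<n}" unfolding S_circ_def using S_seq_subset[OF E D] by blast
  have "\<forall>(i, j)\<in>E. i \<in> S_circ E D C - C \<longrightarrow> j \<in> S_circ E D C"
  proof clarify
    fix i j assume "(i, j) \<in> E" "i \<in> S_circ E D C" "i \<notin> C"
    then obtain k where "i \<in> S_seq E D C k" unfolding S_circ_def by blast
    then have "j \<in> S_seq E D C (Suc k)" using \<open>(i, j) \<in> E\<close> \<open>i \<notin> C\<close> by auto
    then show "j \<in> S_circ E D C" unfolding S_circ_def by blast
  qed
  then show "CA_invariant n C A (S_circ E D C)" using CA_invariant_iff[OF dg sub] by blast
  show "S_circ E D C \<subseteq> W" if W: "D \<subseteq> W" "W \<subseteq> {..<n}" and inv: "CA_invariant n C A W"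
  proof -
    have edge: "\<forall>(i, j)\<in>E. i \<in> W - C \<longrightarrow> j \<in> W" using CA_invariant_iff[OF dg] W inv by blast
    have "S_seq E D C k \<subseteq> W" for k
      using W edge by (induction k) auto
    then show ?thesis unfolding S_circ_def by blast
  qed
qed

section \<open>Compensators\<close>

type_synonym compensator = "real mat \<times> real mat \<times> real mat \<times> real mat"

definition full_order_compensators ::
  "nat \<Rightarrow> real mat \<Rightarrow> nat set \<Rightarrow> nat set \<Rightarrow> nat set \<Rightarrow> nat set \<Rightarrow> compensator set" where
  "full_order_compensators n A B C S Z =
     (let Bm = basis_mat n B; Cm = transpose_mat (basis_mat n C) in
      {(A - Bm * F - H * Cm + Bm * G * Cm, H - Bm * G, F - G * Cm, G) | F G H.
         F \<in> carrier_mat (card B) n \<and> G \<in> carrier_mat (card B) (card C) \<and>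
         H \<in> carrier_mat n (card C) \<and>
         (\<forall>x\<in>node_space n S. (A - Bm * G * Cm) *\<^sub>v x \<in> node_space n Z) \<and>
         (\<forall>x\<in>node_space n Z. (A - Bm * F) *\<^sub>v x \<in> node_space n Z) \<and>
         (\<forall>x\<in>node_space n S. (A - H * Cm) *\<^sub>v x \<in> node_space n S)})"

fun reduce_compensator :: "real mat \<Rightarrow> compensator \<Rightarrow> compensator" where
  "reduce_compensator P (K, L, M, G) =
     (P * K * transpose_mat P, P * L, M * transpose_mat P, G)"

definition reduced_order_compensators ::
  "nat \<Rightarrow> real mat \<Rightarrow> nat set \<Rightarrow> nat set \<Rightarrow> nat set \<Rightarrow> nat set \<Rightarrow> compensator set" where
  "reduced_order_compensators n A B C S Z =
     reduce_compensator (transpose_mat (basis_mat n (Z - S))) `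
       full_order_compensators n A B C S Z"

section \<open>Disturbance decoupling by dynamical output feedback\<close>

text \<open>Transfer matrices have entries in the field \<open>real poly fract\<close> of real rational
  functions, and \<open>char_poly_matrix A\<close> is the polynomial matrix \<open>s I - A\<close>.\<close>

definition rat_mat :: "real mat \<Rightarrow> real poly fract mat" where
  "rat_mat X = map_mat (\<lambda>a. to_fract [:a:]) X"

definition resolvent :: "real mat \<Rightarrow> real poly fract mat" where
  "resolvent A = the (mat_inverse (map_mat to_fract (char_poly_matrix A)))"

lemma resolvent_inverse:
  assumes A: "A \<in> carrier_mat n n"
  shows "resolvent A \<in> carrier_mat n n"
    and "map_mat to_fract (char_poly_matrix A) * resolvent A = 1\<^sub>m n"
    and "resolvent A * map_mat to_fract (char_poly_matrix A) = 1\<^sub>m n"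
proof -
  interpret comm_ring_hom "to_fract :: real poly \<Rightarrow> real poly fract"
    by unfold_locales auto
  let ?M = "map_mat to_fract (char_poly_matrix A)"
  have M: "?M \<in> carrier_mat n n" using A by simp
  have "char_poly A \<noteq> 0" using degree_monic_char_poly[OF A] by auto
  then have "det ?M \<noteq> 0" unfolding hom_det char_poly_def by simp
  then have "?M \<in> Units (ring_mat TYPE(real poly fract) n ())"
    by (rule det_non_zero_imp_unit[OF M])
  then have "mat_inverse ?M \<noteq> None" using mat_inverse(1)[OF M, of "()"] by blast
  then have "mat_inverse ?M = Some (resolvent A)" unfolding resolvent_def by auto
  from mat_inverse(2)[OF M this]
  show "resolvent A \<in> carrier_mat n n" "?M * resolvent A = 1\<^sub>m n" "resolvent A * ?M = 1\<^sub>m n"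
    by auto
qed

definition compensator_of_order ::
  "nat \<Rightarrow> nat set \<Rightarrow> nat set \<Rightarrow> compensator \<Rightarrow> bool" where
  "compensator_of_order r B C = (\<lambda>(K, L, M, G).
     K \<in> carrier_mat r r \<and> L \<in> carrier_mat r (card C) \<and>
     M \<in> carrier_mat (card B) r \<and> G \<in> carrier_mat (card B) (card C))"

definition solves_DDPDF ::
  "nat \<Rightarrow> real mat \<Rightarrow> nat set \<Rightarrow> nat set \<Rightarrow> nat set \<Rightarrow> nat set \<Rightarrow> compensator \<Rightarrow> bool" where
  "solves_DDPDF n A B C D T = (\<lambda>(K, L, M, G).
     let r = dim_row K;
         Bm = basis_mat n B; Cm = transpose_mat (basis_mat n C);
         Dm = basis_mat n D; Tm = transpose_mat (basis_mat n T);
         Ac = four_block_mat (A - Bm * G * Cm) (- (Bm * M)) (L * Cm) K;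
         Dc = Dm @\<^sub>r 0\<^sub>m r (card D);
         Tc = four_block_mat Tm (0\<^sub>m (card T) r) (0\<^sub>m 0 n) (0\<^sub>m 0 r)
     in rat_mat Tc * resolvent Ac * rat_mat Dc = 0\<^sub>m (card T) (card D))"

end

theory Submission
  imports Defs
begin

text \<open>Because \<open>C\<close> is the in-boundary of \<open>S\<close> it lies inside \<open>S\<close>, and because \<open>B\<close> is the
  out-boundary of \<open>Z\<close> it is disjoint from \<open>Z\<close>. Hence each of the three conditions on the gains decouples into independent
  scalar equations. An edge that leaves \<open>Z\<close> ends in \<open>B\<close>, so \<open>A - B F\<close> preserves \<open>Z\<close> exactly when
  the columns of \<open>F\<close> indexed by \<open>Z\<close> agree with those of \<open>B\<^sup>T A\<close>; the remaining columns are free,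
  which is the term \<open>N\<^sub>1 (Z\<^sup>\<bottom>)\<^sup>T\<close> (\<open>state_feedback_iff\<close>). Dually, an edge that leaves \<open>S\<close> starts in
  \<open>C\<close>, so the rows of \<open>H\<close> outside \<open>S\<close> are those of \<open>A C\<^sup>T\<close> and the rows inside \<open>S\<close> are free, which
  is the term \<open>S N\<^sub>2\<close> (\<open>output_injection_iff\<close>). For \<open>G\<close> every entry is determined, since each one
  is the only means of cancelling an edge from \<open>C \<subseteq> S\<close> to \<open>B\<close>, which avoids \<open>Z\<close>
  (\<open>output_feedback_iff\<close>). Inserting these gains in the formulas for \<open>K\<close>, \<open>L\<close>, \<open>M\<close> is an algebraic
  rearrangement (\<open>compensator_gain_formulas\<close>). The reduction keeps only the nodes of \<open>Z - S\<close>, on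
  which both free terms vanish; so all full-order compensators have the same reduction
  (\<open>reduce_compensator_cancels\<close>).

  The reduction solves the decoupling problem (\<open>reduced_compensator_decouples\<close>) because the closed
  loop leaves invariant the space of all pairs \<open>(x, P x)\<close> with \<open>x \<in> Z\<close>, in which the compensator
  state \<open>w = P x\<close> consists of the coordinates of \<open>x\<close> in \<open>Z - S\<close>. Indeed the plant state then moves
  through \<open>A - B G C\<close> on \<open>S\<close> and through \<open>A - B F\<close> on \<open>Z - S\<close>, both of which map into \<open>Z\<close>, and the
  error \<open>P x - w\<close> changes at the rate \<open>P (A - H C) x\<^sub>S\<close>, where \<open>x\<^sub>S\<close> is the part of \<open>x\<close> in \<open>S\<close>;
  this is zero since \<open>A - H C\<close> preserves \<open>S\<close>. The disturbance enters in this space because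
  \<open>D \<subseteq> S\<close>, and the target does not see it because \<open>Z\<close> avoids \<open>T\<close>; an invariant subspace containing
  the image of the input matrix and lying in the kernel of the output matrix makes the transfer
  matrix zero (\<open>transfer_matrix_zero\<close>).\<close>

section \<open>Selecting rows and columns with basis matrices\<close>

lemma sorted_nodes:
  fixes W :: "nat set"
  assumes "W \<subseteq> {..<n}"
  shows "k < card W \<Longrightarrow> sorted_list_of_set W ! k \<in> W"
    and "i \<in> W \<Longrightarrow> \<exists>k<card W. sorted_list_of_set W ! k = i"
    and "k < card W \<Longrightarrow> sorted_list_of_set W ! k < n"
proof -
  have fin: "finite W" by (rule finite_subset[OF assms finite_lessThan])
  show 1: "sorted_list_of_set W ! k \<in> W" if "k < card W" for k
    using that fin nth_mem[of k "sorted_list_of_set W"] by simp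
  show "\<exists>k<card W. sorted_list_of_set W ! k = i" if "i \<in> W"
    using that fin in_set_conv_nth[of i "sorted_list_of_set W"] by auto
  show "sorted_list_of_set W ! k < n" if "k < card W" using 1[OF that] assms by blast
qed

lemma basis_mat_dim [simp]:
  "dim_row (basis_mat n W) = n" "dim_col (basis_mat n W) = card W"
  using basis_mat_carrier[of n W] unfolding carrier_mat_def by blast+

lemma basis_mat_index:
  assumes "W \<subseteq> {..<n}" "i < n" "k < card W"
  shows "basis_mat n W $$ (i, k) = (if i = sorted_list_of_set W ! k then 1 else 0)"
  using assms sorted_nodes(3)[OF assms(1,3)] unfolding basis_mat_def
  by (simp add: mat_of_cols_index unit_vec_def)

text \<open>Multiplication by a basis matrix or by its transpose only selects, or inserts among zeros, rows
  or columns. The following rules turn every later matrix condition into conditions on single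
  entries.\<close>

lemma mult_basis_mat_index:
  assumes W: "W \<subseteq> {..<n}" and X: "X \<in> carrier_mat m n" and i: "i < m" and k: "k < card W"
  shows "(X * basis_mat n W) $$ (i, k) = X $$ (i, sorted_list_of_set W ! k)"
proof -
  have "(X * basis_mat n W) $$ (i, k) = (\<Sum>j = 0..<n. X $$ (i, j) * basis_mat n W $$ (j, k))"
    using X i k by (auto simp: scalar_prod_def intro!: sum.cong)
  also have "\<dots> = (\<Sum>j = 0..<n. if sorted_list_of_set W ! k = j then X $$ (i, j) else 0)"
    using basis_mat_index[OF W _ k] by (intro sum.cong) auto
  finally show ?thesis using sorted_nodes(3)[OF W k] by simp
qed

lemma basis_mat_transpose_mult_index:
  assumes W: "W \<subseteq> {..<n}" and X: "X \<in> carrier_mat n m" and k: "k < card W" and j: "j < m"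
  shows "(transpose_mat (basis_mat n W) * X) $$ (k, j) = X $$ (sorted_list_of_set W ! k, j)"
proof -
  have "transpose_mat (basis_mat n W) * X = transpose_mat (transpose_mat X * basis_mat n W)"
    using X by (subst transpose_mult[of _ m n _ "card W"]) auto
  then show ?thesis
    using mult_basis_mat_index[OF W _ j k, of "transpose_mat X"] X j k sorted_nodes(3)[OF W k]
    by simp
qed

lemma basis_mat_mult_index:
  assumes W: "W \<subseteq> {..<n}" and X: "X \<in> carrier_mat (card W) m" and j: "j < m"
  shows "k < card W \<Longrightarrow> (basis_mat n W * X) $$ (sorted_list_of_set W ! k, j) = X $$ (k, j)"
    and "i < n \<Longrightarrow> i \<notin> W \<Longrightarrow> (basis_mat n W * X) $$ (i, j) = 0"
proof -
  have prod: "(basis_mat n W * X) $$ (i, j) =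
      (\<Sum>l = 0..<card W. if i = sorted_list_of_set W ! l then X $$ (l, j) else 0)" if i: "i < n" for i
  proof -
    have "(basis_mat n W * X) $$ (i, j) = (\<Sum>l = 0..<card W. basis_mat n W $$ (i, l) * X $$ (l, j))"
      using X i j by (auto simp: scalar_prod_def intro!: sum.cong)
    then show ?thesis using basis_mat_index[OF W i] by (auto intro!: sum.cong)
  qed
  have "distinct (sorted_list_of_set W)" by simp
  show "(basis_mat n W * X) $$ (sorted_list_of_set W ! k, j) = X $$ (k, j)" if k: "k < card W"
  proof -
    have "(basis_mat n W * X) $$ (sorted_list_of_set W ! k, j) =
        (\<Sum>l = 0..<card W. if k = l then X $$ (l, j) else 0)"
      unfolding prod[OF sorted_nodes(3)[OF W k]] using k
      by (intro sum.cong) (auto simp: nth_eq_iff_index_eq)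
    then show ?thesis using k by simp
  qed
  show "(basis_mat n W * X) $$ (i, j) = 0" if "i < n" "i \<notin> W"
    unfolding prod[OF that(1)] using sorted_nodes(1)[OF W] that(2) by (intro sum.neutral) auto
qed

lemma mult_basis_mat_transpose_index:
  assumes W: "W \<subseteq> {..<n}" and X: "X \<in> carrier_mat m (card W)" and i: "i < m"
  shows "k < card W \<Longrightarrow>
      (X * transpose_mat (basis_mat n W)) $$ (i, sorted_list_of_set W ! k) = X $$ (i, k)"
    and "j < n \<Longrightarrow> j \<notin> W \<Longrightarrow> (X * transpose_mat (basis_mat n W)) $$ (i, j) = 0"
proof -
  have tr: "X * transpose_mat (basis_mat n W) = transpose_mat (basis_mat n W * transpose_mat X)"
    using X by (simp add: transpose_mult[of _ n "card W" _ m])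
  have Xt: "transpose_mat X \<in> carrier_mat (card W) m" using X by simp
  have dim: "(X * transpose_mat (basis_mat n W)) $$ (i, j) = (basis_mat n W * transpose_mat X) $$ (j, i)"
    if "j < n" for j
    unfolding tr using that i X by simp
  show "(X * transpose_mat (basis_mat n W)) $$ (i, sorted_list_of_set W ! k) = X $$ (i, k)"
    if k: "k < card W"
    using dim[OF sorted_nodes(3)[OF W k]] basis_mat_mult_index(1)[OF W Xt i k] X i k by simp
  show "(X * transpose_mat (basis_mat n W)) $$ (i, j) = 0" if "j < n" "j \<notin> W"
    using dim[OF that(1)] basis_mat_mult_index(2)[OF W Xt i that] by simp
qed

definition coord_proj :: "nat \<Rightarrow> nat set \<Rightarrow> real mat" where
  "coord_proj n W = basis_mat n W * transpose_mat (basis_mat n W)"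

lemma coord_proj_carrier [simp]: "coord_proj n W \<in> carrier_mat n n"
  unfolding coord_proj_def by (rule mult_carrier_mat[of _ _ "card W"]) auto

lemma coord_proj_dim [simp]: "dim_row (coord_proj n W) = n" "dim_col (coord_proj n W) = n"
  using coord_proj_carrier[of n W] unfolding carrier_mat_def by blast+

lemma coord_proj_mult_index:
  assumes W: "W \<subseteq> {..<n}" and X: "X \<in> carrier_mat n m" and i: "i < n" and j: "j < m"
  shows "(coord_proj n W * X) $$ (i, j) = (if i \<in> W then X $$ (i, j) else 0)"
proof -
  have tX: "transpose_mat (basis_mat n W) * X \<in> carrier_mat (card W) m"
    using X by (intro mult_carrier_mat[of _ _ n]) auto
  have assoc: "coord_proj n W * X = basis_mat n W * (transpose_mat (basis_mat n W) * X)"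
    unfolding coord_proj_def using X by (intro assoc_mult_mat[of _ n "card W" _ n _ m]) auto
  show ?thesis
  proof (cases "i \<in> W")
    case True
    then obtain k where k: "k < card W" "sorted_list_of_set W ! k = i"
      using sorted_nodes(2)[OF W] by blast
    then show ?thesis
      using basis_mat_mult_index(1)[OF W tX j k(1)] basis_mat_transpose_mult_index[OF W X k(1) j] True
      unfolding assoc by simp
  next
    case False
    then show ?thesis using basis_mat_mult_index(2)[OF W tX j i] unfolding assoc by simp
  qed
qed

lemma mult_coord_proj_index:
  assumes W: "W \<subseteq> {..<n}" and X: "X \<in> carrier_mat m n" and i: "i < m" and j: "j < n"
  shows "(X * coord_proj n W) $$ (i, j) = (if j \<in> W then X $$ (i, j) else 0)"
proof -
  have Xt: "X * basis_mat n W \<in> carrier_mat m (card W)"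
    using X by (intro mult_carrier_mat[of _ _ n]) auto
  have assoc: "X * coord_proj n W = X * basis_mat n W * transpose_mat (basis_mat n W)"
    unfolding coord_proj_def using X
    by (intro assoc_mult_mat[symmetric, of _ m n _ "card W" _ n]) auto
  show ?thesis
  proof (cases "j \<in> W")
    case True
    then obtain k where k: "k < card W" "sorted_list_of_set W ! k = j"
      using sorted_nodes(2)[OF W] by blast
    then show ?thesis
      using mult_basis_mat_transpose_index(1)[OF W Xt i k(1)] mult_basis_mat_index[OF W X i k(1)] True
      unfolding assoc by simp
  next
    case False
    then show ?thesis using mult_basis_mat_transpose_index(2)[OF W Xt i j] unfolding assoc by simp
  qed
qed

text \<open>The matrices of the form \<open>S N\<^sub>2\<close> and \<open>N\<^sub>1 (Z\<^sup>\<bottom>)\<^sup>T\<close> are recognised by their zero rows and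
  columns. The coordinate projection onto \<open>W\<close> fixes such a matrix, and splitting the projection into
  its two factors exhibits \<open>N\<close>.\<close>

lemma basis_mat_factor_iff:
  assumes W: "W \<subseteq> {..<n}" and X: "X \<in> carrier_mat n m"
  shows "(\<exists>N\<in>carrier_mat (card W) m. X = basis_mat n W * N) \<longleftrightarrow>
    (\<forall>i<n. \<forall>j<m. i \<notin> W \<longrightarrow> X $$ (i, j) = 0)"
proof
  assume "\<exists>N\<in>carrier_mat (card W) m. X = basis_mat n W * N"
  then show "\<forall>i<n. \<forall>j<m. i \<notin> W \<longrightarrow> X $$ (i, j) = 0" using basis_mat_mult_index(2)[OF W] by auto
next
  let ?N = "transpose_mat (basis_mat n W) * X"
  assume 0: "\<forall>i<n. \<forall>j<m. i \<notin> W \<longrightarrow> X $$ (i, j) = 0"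
  have N: "?N \<in> carrier_mat (card W) m" using X by (intro mult_carrier_mat[of _ _ n]) auto
  have "coord_proj n W * X = X"
    using X 0 coord_proj_mult_index[OF W X]
    by (intro eq_matI) auto
  moreover have "coord_proj n W * X = basis_mat n W * ?N"
    unfolding coord_proj_def using X by (intro assoc_mult_mat[of _ n "card W" _ n _ m]) auto
  ultimately show "\<exists>N\<in>carrier_mat (card W) m. X = basis_mat n W * N" using N by metis
qed

lemma basis_mat_transpose_factor_iff:
  assumes W: "W \<subseteq> {..<n}" and X: "X \<in> carrier_mat m n"
  shows "(\<exists>N\<in>carrier_mat m (card W). X = N * transpose_mat (basis_mat n W)) \<longleftrightarrow>
    (\<forall>i<m. \<forall>j<n. j \<notin> W \<longrightarrow> X $$ (i, j) = 0)"
proof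
  assume "\<exists>N\<in>carrier_mat m (card W). X = N * transpose_mat (basis_mat n W)"
  then show "\<forall>i<m. \<forall>j<n. j \<notin> W \<longrightarrow> X $$ (i, j) = 0"
    using mult_basis_mat_transpose_index(2)[OF W] by auto
next
  let ?N = "X * basis_mat n W"
  assume 0: "\<forall>i<m. \<forall>j<n. j \<notin> W \<longrightarrow> X $$ (i, j) = 0"
  have N: "?N \<in> carrier_mat m (card W)" using X by (intro mult_carrier_mat[of _ _ n]) auto
  have "X * coord_proj n W = X"
    using X 0 mult_coord_proj_index[OF W X]
    by (intro eq_matI) auto
  moreover have "X * coord_proj n W = ?N * transpose_mat (basis_mat n W)"
    unfolding coord_proj_def using X
    by (intro assoc_mult_mat[symmetric, of _ m n _ "card W" _ n]) auto
  ultimately show "\<exists>N\<in>carrier_mat m (card W). X = N * transpose_mat (basis_mat n W)"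
    using N by metis
qed

lemma basis_mat_orthogonal:
  assumes V: "V \<subseteq> {..<n}" and W: "W \<subseteq> {..<n}" and disj: "V \<inter> W = {}"
  shows "transpose_mat (basis_mat n V) * basis_mat n W = 0\<^sub>m (card V) (card W)"
proof (rule eq_matI)
  fix k l assume "k < dim_row (0\<^sub>m (card V) (card W))" "l < dim_col (0\<^sub>m (card V) (card W))"
  then have k: "k < card V" and l: "l < card W" by auto
  show "(transpose_mat (basis_mat n V) * basis_mat n W) $$ (k, l) = 0\<^sub>m (card V) (card W) $$ (k, l)"
    using basis_mat_transpose_mult_index[OF V basis_mat_carrier k l]
      basis_mat_index[OF W sorted_nodes(3)[OF V k] l]
      sorted_nodes(1)[OF V k] sorted_nodes(1)[OF W l] disj k l
    by auto
qed auto

section \<open>Linear maps between coordinate subspaces\<close>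

lemma maps_node_space_iff:
  assumes V: "V \<subseteq> {..<n}" and W: "W \<subseteq> {..<n}" and X: "X \<in> carrier_mat n n"
  shows "(\<forall>x\<in>node_space n V. X *\<^sub>v x \<in> node_space n W) \<longleftrightarrow>
    (\<forall>i\<in>V. \<forall>j<n. j \<notin> W \<longrightarrow> X $$ (j, i) = 0)"
proof
  assume maps: "\<forall>x\<in>node_space n V. X *\<^sub>v x \<in> node_space n W"
  show "\<forall>i\<in>V. \<forall>j<n. j \<notin> W \<longrightarrow> X $$ (j, i) = 0"
  proof (intro ballI allI impI)
    fix i j assume i: "i \<in> V" and j: "j < n" "j \<notin> W"
    have "X *\<^sub>v unit_vec n i \<in> node_space n W"
      using maps unit_vec_node_space[OF V i] by blast
    then have "(X *\<^sub>v unit_vec n i) $ j = 0" using node_space_iff[OF W] j by auto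
    then show "X $$ (j, i) = 0" using mult_unit_vec[OF X _ j(1)] i V by auto
  qed
next
  assume 0: "\<forall>i\<in>V. \<forall>j<n. j \<notin> W \<longrightarrow> X $$ (j, i) = 0"
  show "\<forall>x\<in>node_space n V. X *\<^sub>v x \<in> node_space n W"
  proof
    fix x assume x: "x \<in> node_space n V"
    then have xc: "x \<in> carrier_vec n" and x0: "\<And>i. i < n \<Longrightarrow> i \<notin> V \<Longrightarrow> x $ i = 0"
      using node_space_iff[OF V] by auto
    have "(X *\<^sub>v x) $ j = 0" if j: "j < n" "j \<notin> W" for j
    proof -
      have "(X *\<^sub>v x) $ j = (\<Sum>i = 0..<n. X $$ (j, i) * x $ i)"
        using X xc j by (auto simp: scalar_prod_def intro!: sum.cong)
      also have "\<dots> = 0"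
        using 0 x0 j by (intro sum.neutral ballI) (metis atLeastLessThan_iff mult_eq_0_iff)
      finally show ?thesis .
    qed
    then show "X *\<^sub>v x \<in> node_space n W" using node_space_iff[OF W] X xc by auto
  qed
qed

section \<open>Invariant subspaces and transfer matrices\<close>

lemma rat_mat_carrier [simp]: "rat_mat X \<in> carrier_mat m k \<longleftrightarrow> X \<in> carrier_mat m k"
  by (simp add: rat_mat_def)

lemma rat_mat_mult:
  assumes "X \<in> carrier_mat m k" "Y \<in> carrier_mat k l"
  shows "rat_mat (X * Y) = rat_mat X * rat_mat Y"
proof -
  interpret semiring_hom "\<lambda>a::real. to_fract [:a:]"
    by unfold_locales (auto simp flip: one_pCons to_fract_add to_fract_mult)
  show ?thesis unfolding rat_mat_def by (rule mat_hom_mult[OF assms])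
qed

text \<open>This is \<open>s I - X\<close> with \<open>s\<close> read as an element of the field of rational functions, the form
  in which matrices over that field can be multiplied.\<close>

lemma char_poly_matrix_rat:
  assumes "X \<in> carrier_mat m m"
  shows "map_mat to_fract (char_poly_matrix X) = to_fract [:0, 1:] \<cdot>\<^sub>m 1\<^sub>m m - rat_mat X"
  using assms
  by (intro eq_matI)
     (auto simp: char_poly_matrix_def rat_mat_def simp flip: to_fract_diff to_fract_uminus)

text \<open>From \<open>X U = U Q\<close> follows \<open>(s I - X) U = U (s I - Q)\<close>; multiplying by the two resolvents, one on
  each side, gives the claim.\<close>

lemma resolvent_intertwine:
  assumes X: "X \<in> carrier_mat m m" and Q: "Q \<in> carrier_mat k k" and U: "U \<in> carrier_mat m k"
    and XU: "X * U = U * Q"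
  shows "resolvent X * rat_mat U = rat_mat U * resolvent Q"
proof -
  let ?s = "to_fract [:0, 1:] :: real poly fract"
  let ?X = "map_mat to_fract (char_poly_matrix X)" and ?Q = "map_mat to_fract (char_poly_matrix Q)"
  let ?U = "rat_mat U"
  note rX = resolvent_inverse[OF X] and rQ = resolvent_inverse[OF Q]
  have Xc: "?X \<in> carrier_mat m m" and Qc: "?Q \<in> carrier_mat k k" and Uc: "?U \<in> carrier_mat m k"
    using X Q U by auto
  have "?X * ?U = ?s \<cdot>\<^sub>m ?U - rat_mat X * ?U"
    unfolding char_poly_matrix_rat[OF X] using X Uc
    by (subst minus_mult_distrib_mat[of _ m m]) (auto simp: mult_smult_assoc_mat[of _ m m _ k])
  moreover have "?U * ?Q = ?s \<cdot>\<^sub>m ?U - ?U * rat_mat Q"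
    unfolding char_poly_matrix_rat[OF Q] using Q Uc
    by (subst mult_minus_distrib_mat[of _ m k]) (auto simp: mult_smult_distrib[of _ m k _ k])
  ultimately have XU': "?X * ?U = ?U * ?Q"
    using rat_mat_mult[OF X U] rat_mat_mult[OF U Q] XU by simp
  have "resolvent X * ?U = resolvent X * (?U * (?Q * resolvent Q))"
    using rQ(2) Uc by simp
  also have "\<dots> = resolvent X * (?U * ?Q * resolvent Q)"
    using assoc_mult_mat[OF Uc Qc rQ(1)] by simp
  also have "\<dots> = resolvent X * (?X * (?U * resolvent Q))"
    unfolding XU'[symmetric] using assoc_mult_mat[OF Xc Uc rQ(1)] by simp
  also have "\<dots> = resolvent X * ?X * (?U * resolvent Q)"
    using assoc_mult_mat[OF rX(1) Xc mult_carrier_mat[OF Uc rQ(1)]] by simp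
  also have "\<dots> = ?U * resolvent Q"
    unfolding rX(3) by (rule left_mult_one_mat[OF mult_carrier_mat[OF Uc rQ(1)]])
  finally show ?thesis .
qed

text \<open>The range of \<open>R\<close> is an \<open>X\<close>-invariant subspace that contains the columns of \<open>Dm\<close> and is
  annihilated by \<open>Tm\<close>. Describing the subspace by a square matrix \<open>R\<close> that acts as the identity on
  it avoids choosing a basis: the restriction of \<open>X\<close> to the subspace is represented by \<open>X R\<close>, and
  the intertwining \<open>X R = R (X R)\<close> moves the resolvent past \<open>R\<close>, so that the product \<open>Tm R = 0\<close> appears.\<close>

lemma transfer_matrix_zero:
  assumes X: "X \<in> carrier_mat m m" and R: "R \<in> carrier_mat m m"
    and Dm: "Dm \<in> carrier_mat m d" and Tm: "Tm \<in> carrier_mat t m"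
    and inv: "R * (X * R) = X * R" and D: "R * Dm = Dm" and T: "Tm * R = 0\<^sub>m t m"
  shows "rat_mat Tm * resolvent X * rat_mat Dm = 0\<^sub>m t d"
proof -
  let ?Q = "X * R"
  have Q: "?Q \<in> carrier_mat m m" using X R by simp
  note rX = resolvent_inverse(1)[OF X] and rQ = resolvent_inverse(1)[OF Q]
  have Rc: "rat_mat R \<in> carrier_mat m m" and Dc: "rat_mat Dm \<in> carrier_mat m d"
    and Tc: "rat_mat Tm \<in> carrier_mat t m" using R Dm Tm by auto
  have "rat_mat Tm * resolvent X * rat_mat Dm = rat_mat Tm * (resolvent X * rat_mat (R * Dm))"
    unfolding D using assoc_mult_mat[OF Tc rX Dc] .
  also have "\<dots> = rat_mat Tm * (resolvent X * rat_mat R * rat_mat Dm)"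
    using rat_mat_mult[OF R Dm] assoc_mult_mat[OF rX Rc Dc] by simp
  also have "\<dots> = rat_mat Tm * (rat_mat R * (resolvent ?Q * rat_mat Dm))"
    using resolvent_intertwine[OF X Q R inv[symmetric]] assoc_mult_mat[OF Rc rQ Dc] by simp
  also have "\<dots> = rat_mat (Tm * R) * (resolvent ?Q * rat_mat Dm)"
    using rat_mat_mult[OF Tm R] assoc_mult_mat[OF Tc Rc mult_carrier_mat[OF rQ Dc]] by simp
  also have "rat_mat (Tm * R) = 0\<^sub>m t m"
    unfolding T by (intro eq_matI) (auto simp: rat_mat_def)
  finally show ?thesis using left_mult_zero_mat[OF mult_carrier_mat[OF rQ Dc]] by simp
qed


section \<open>Disturbance decoupling by compensators\<close>

text \<open>The matrices \<open>XG\<close>, \<open>XF\<close>, \<open>XH\<close> stand for \<open>A - B G C\<close>, \<open>A - B F\<close>, \<open>A - H C\<close>. On the vectors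
  \<open>(x, P x)\<close> with \<open>x \<in> Z\<close> the plant part of the closed loop acts as \<open>X\<close>, since \<open>B M = XG - XF\<close>. The
  compensator part acts as the left-hand side of the second equation, since \<open>L C = XG - XH\<close> and
  \<open>K = XF + XH - XG\<close>. The matrix \<open>X\<close> and the one that \<open>P\<close> multiplies there both have the columns of
  \<open>XF\<close> on \<open>Z - S\<close>; on \<open>S\<close> their columns are those of \<open>XG\<close> and of \<open>XG - XH\<close>, and \<open>P\<close> does not see the difference because \<open>XH\<close> maps \<open>S\<close> into \<open>S\<close>. Together, the two equations
  say that the image \<open>(x', w')\<close> of such a vector again satisfies \<open>x' \<in> Z\<close> and \<open>w' = P x'\<close>.\<close>

lemma closed_loop_projection:
  assumes Z: "Z \<subseteq> {..<n}" and SZ: "S \<subseteq> Z"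
    and XG: "XG \<in> carrier_mat n n" and XF: "XF \<in> carrier_mat n n" and XH: "XH \<in> carrier_mat n n"
    and g0: "\<And>i j. i \<in> S \<Longrightarrow> j < n \<Longrightarrow> j \<notin> Z \<Longrightarrow> XG $$ (j, i) = 0"
    and f0: "\<And>i j. i \<in> Z \<Longrightarrow> j < n \<Longrightarrow> j \<notin> Z \<Longrightarrow> XF $$ (j, i) = 0"
    and h0: "\<And>i j. i \<in> S \<Longrightarrow> j < n \<Longrightarrow> j \<notin> S \<Longrightarrow> XH $$ (j, i) = 0"
  defines "X \<equiv> XG * coord_proj n Z + (XF - XG) * coord_proj n (Z - S)"
  shows "coord_proj n Z * X = X"
    and "transpose_mat (basis_mat n (Z - S)) *
        ((XG - XH) * coord_proj n Z + (XF + XH - XG) * coord_proj n (Z - S)) =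
      transpose_mat (basis_mat n (Z - S)) * X"
proof -
  let ?P = "transpose_mat (basis_mat n (Z - S))"
  let ?JZ = "coord_proj n Z" and ?J = "coord_proj n (Z - S)"
  have W: "Z - S \<subseteq> {..<n}" using Z by blast
  have d1: "XG - XH \<in> carrier_mat n n" and d2: "XF + XH - XG \<in> carrier_mat n n"
    and d3: "XF - XG \<in> carrier_mat n n"
    by (rule minus_carrier_mat[OF XH], rule minus_carrier_mat[OF XG], rule minus_carrier_mat[OF XG])
  have X: "X \<in> carrier_mat n n"
    unfolding X_def by (rule add_carrier_mat[OF mult_carrier_mat[OF d3 coord_proj_carrier]])
  have X_index: "X $$ (i, j) = (if j \<in> S then XG $$ (i, j) else if j \<in> Z then XF $$ (i, j) else 0)"
    if ij: "i < n" "j < n" for i j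
  proof -
    have "X $$ (i, j) = (XG * ?JZ) $$ (i, j) + ((XF - XG) * ?J) $$ (i, j)"
      unfolding X_def using ij XG by (simp del: index_mult_mat(1))
    moreover have "(XF - XG) $$ (i, j) = XF $$ (i, j) - XG $$ (i, j)" using ij XG XF by simp
    ultimately show ?thesis
      unfolding mult_coord_proj_index[OF Z XG ij] mult_coord_proj_index[OF W d3 ij]
      using SZ by auto
  qed
  show "?JZ * X = X"
  proof (rule eq_matI)
    fix i j assume "i < dim_row X" "j < dim_col X"
    then have ij: "i < n" "j < n" using X by auto
    show "(?JZ * X) $$ (i, j) = X $$ (i, j)"
      unfolding coord_proj_mult_index[OF Z X ij] X_index[OF ij] using ij g0[of j i] f0[of j i] by auto
  qed (use X in auto)
  let ?V = "(XG - XH) * ?JZ + (XF + XH - XG) * ?J"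
  have V: "?V \<in> carrier_mat n n"
    by (rule add_carrier_mat[OF mult_carrier_mat[OF d2 coord_proj_carrier]])
  have V_index: "?V $$ (i, j) =
      (if j \<in> S then XG $$ (i, j) - XH $$ (i, j) else if j \<in> Z then XF $$ (i, j) else 0)"
    if ij: "i < n" "j < n" for i j
  proof -
    have "?V $$ (i, j) = ((XG - XH) * ?JZ) $$ (i, j) + ((XF + XH - XG) * ?J) $$ (i, j)"
      using ij XG by (simp del: index_mult_mat(1))
    moreover have "(XG - XH) $$ (i, j) = XG $$ (i, j) - XH $$ (i, j)"
      "(XF + XH - XG) $$ (i, j) = XF $$ (i, j) + XH $$ (i, j) - XG $$ (i, j)"
      using ij XG XF XH by simp_all
    ultimately show ?thesis
      unfolding mult_coord_proj_index[OF Z d1 ij] mult_coord_proj_index[OF W d2 ij] using SZ by auto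
  qed
  show "?P * ?V = ?P * X"
  proof (rule eq_matI)
    fix k j assume "k < dim_row (?P * X)" "j < dim_col (?P * X)"
    then have k: "k < card (Z - S)" and j: "j < n" using X by auto
    let ?i = "sorted_list_of_set (Z - S) ! k"
    have i: "?i < n" "?i \<in> Z" "?i \<notin> S" using sorted_nodes[OF W] k by auto
    show "(?P * ?V) $$ (k, j) = (?P * X) $$ (k, j)"
      unfolding basis_mat_transpose_mult_index[OF W V k j]
        basis_mat_transpose_mult_index[OF W X k j] V_index[OF i(1) j] X_index[OF i(1) j]
      using h0[of j ?i] i by simp
  qed (use X V in auto)
qed

text \<open>The projection \<open>Q\<close> below sends \<open>(x, w)\<close> to \<open>(J x, P J x)\<close>, where \<open>J\<close> is the projection onto \<open>Z\<close>.
  Its range is the space of pairs \<open>(x, P x)\<close> with \<open>x \<in> Z\<close>; the lower left block is only \<open>P\<close>, since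
  \<open>P J = P\<close>.\<close>

lemma reduced_compensator_decouples:
  assumes A: "A \<in> carrier_mat n n" and B: "B \<subseteq> {..<n}" and C: "C \<subseteq> {..<n}"
    and T: "T \<subseteq> {..<n}" and Z: "Z \<subseteq> {..<n}"
    and SZ: "S \<subseteq> Z" and DS: "D \<subseteq> S" and ZT: "Z \<inter> T = {}"
    and R: "R \<in> reduced_order_compensators n A B C S Z"
  shows "compensator_of_order (card Z - card S) B C R \<and> solves_DDPDF n A B C D T R"
proof -
  let ?B = "basis_mat n B" and ?C = "transpose_mat (basis_mat n C)"
  let ?D = "basis_mat n D" and ?T = "transpose_mat (basis_mat n T)"
  let ?r = "card (Z - S)"
  let ?Pt = "basis_mat n (Z - S)" and ?JZ = "coord_proj n Z" and ?J = "coord_proj n (Z - S)"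
  let ?P = "transpose_mat ?Pt"
  have S: "S \<subseteq> {..<n}" and D: "D \<subseteq> {..<n}" and W: "Z - S \<subseteq> {..<n}" using Z SZ DS by auto
  have r: "?r = card Z - card S"
    using SZ finite_subset[OF S] by (simp add: card_Diff_subset)
  have Pt: "?Pt \<in> carrier_mat n ?r" and P: "?P \<in> carrier_mat ?r n" by auto
  from R obtain F G H where F: "F \<in> carrier_mat (card B) n"
    and G: "G \<in> carrier_mat (card B) (card C)" and H: "H \<in> carrier_mat n (card C)"
    and gm: "\<forall>x\<in>node_space n S. (A - ?B * G * ?C) *\<^sub>v x \<in> node_space n Z"
    and fm: "\<forall>x\<in>node_space n Z. (A - ?B * F) *\<^sub>v x \<in> node_space n Z"
    and hm: "\<forall>x\<in>node_space n S. (A - H * ?C) *\<^sub>v x \<in> node_space n S"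
    and Req: "R = reduce_compensator ?P
      (A - ?B * F - H * ?C + ?B * G * ?C, H - ?B * G, F - G * ?C, G)"
    unfolding reduced_order_compensators_def full_order_compensators_def Let_def by auto
  define K where "K = A - ?B * F - H * ?C + ?B * G * ?C"
  define L where "L = H - ?B * G"
  define M where "M = F - G * ?C"
  define XG where "XG = A - ?B * G * ?C"
  define XF where "XF = A - ?B * F"
  define XH where "XH = A - H * ?C"
  have Bc: "?B \<in> carrier_mat n (card B)" and Cc: "?C \<in> carrier_mat (card C) n" by auto
  have BF: "?B * F \<in> carrier_mat n n" and HC: "H * ?C \<in> carrier_mat n n"
    and BG: "?B * G \<in> carrier_mat n (card C)" and GC: "G * ?C \<in> carrier_mat (card B) n"
    using F G H by (auto intro!: mult_carrier_mat[OF Bc] mult_carrier_mat[OF _ Cc])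
  have BGC: "?B * G * ?C \<in> carrier_mat n n" by (rule mult_carrier_mat[OF BG Cc])
  have K: "K \<in> carrier_mat n n" and L: "L \<in> carrier_mat n (card C)"
    and M: "M \<in> carrier_mat (card B) n"
    unfolding K_def L_def M_def using minus_carrier_mat[OF BG] minus_carrier_mat[OF GC] BGC by auto
  have XG: "XG \<in> carrier_mat n n" and XF: "XF \<in> carrier_mat n n" and XH: "XH \<in> carrier_mat n n"
    unfolding XG_def XF_def XH_def
    using minus_carrier_mat[OF BGC] minus_carrier_mat[OF BF] minus_carrier_mat[OF HC] by auto
  (* The compensator matrices are expressed by the three maps with known zero patterns. *)
  have BM: "?B * M = XG - XF"
  proof -
    have "?B * M = ?B * F - ?B * G * ?C"
      unfolding M_def using mult_minus_distrib_mat[OF Bc F GC] assoc_mult_mat[OF Bc G Cc] by simp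
    then show ?thesis unfolding XG_def XF_def using A BF BGC by (intro eq_matI) auto
  qed
  have LC: "L * ?C = XG - XH"
    unfolding L_def minus_mult_distrib_mat[OF H BG Cc] XG_def XH_def
    using A HC BGC by (intro eq_matI) auto
  have K': "K = XF + XH - XG"
    unfolding K_def XF_def XH_def XG_def using A BF HC BGC by (intro eq_matI) auto
  have g0: "XG $$ (j, i) = 0" if "i \<in> S" "j < n" "j \<notin> Z" for i j
    using gm that unfolding XG_def[symmetric] maps_node_space_iff[OF S Z XG] by blast
  have f0: "XF $$ (j, i) = 0" if "i \<in> Z" "j < n" "j \<notin> Z" for i j
    using fm that unfolding XF_def[symmetric] maps_node_space_iff[OF Z Z XF] by blast
  have h0: "XH $$ (j, i) = 0" if "i \<in> S" "j < n" "j \<notin> S" for i j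
    using hm that unfolding XH_def[symmetric] maps_node_space_iff[OF S S XH] by blast
  let ?Kr = "?P * K * ?Pt" and ?Lr = "?P * L" and ?Mr = "M * ?Pt"
  have PK: "?P * K \<in> carrier_mat ?r n" and Kr: "?Kr \<in> carrier_mat ?r ?r"
    and Lr: "?Lr \<in> carrier_mat ?r (card C)" and Mr: "?Mr \<in> carrier_mat (card B) ?r"
    using K L M P Pt by auto
  have LrC: "?Lr * ?C \<in> carrier_mat ?r n" and BMr: "- (?B * ?Mr) \<in> carrier_mat n ?r"
    using Lr Mr by auto
  have Rq: "R = (?Kr, ?Lr, ?Mr, G)" unfolding Req K_def L_def M_def by simp
  have order: "compensator_of_order (card Z - card S) B C R"
    unfolding Rq compensator_of_order_def r[symmetric] using Kr Lr Mr G by simp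
  define Ac where "Ac = four_block_mat XG (- (?B * ?Mr)) (?Lr * ?C) ?Kr"
  define Q where "Q = four_block_mat ?JZ (0\<^sub>m n ?r) ?P (0\<^sub>m ?r ?r)"
  define Dc where "Dc = four_block_mat ?D (0\<^sub>m n 0) (0\<^sub>m ?r (card D)) (0\<^sub>m ?r 0)"
  define Tc where "Tc = four_block_mat ?T (0\<^sub>m (card T) ?r) (0\<^sub>m 0 n) (0\<^sub>m 0 ?r)"
  define X where "X = XG * ?JZ + - (?B * ?Mr) * ?P"
  define Y where "Y = ?Lr * ?C * ?JZ + ?Kr * ?P"
  have "?B * ?Mr * ?P = (XG - XF) * ?J"
    unfolding coord_proj_def
    using assoc_mult_mat[OF Bc M Pt] assoc_mult_mat[OF mult_carrier_mat[OF Bc M] Pt P] BM by simp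
  then have "- (?B * ?Mr) * ?P = - (XG - XF) * ?J" using XF by simp
  also have "- (XG - XF) = XF - XG" using XG XF by (intro eq_matI) auto
  finally have X': "X = XG * ?JZ + (XF - XG) * ?J" unfolding X_def by simp
  have d1: "XG - XH \<in> carrier_mat n n" and d2: "XF + XH - XG \<in> carrier_mat n n"
    and d3: "XF - XG \<in> carrier_mat n n"
    by (rule minus_carrier_mat[OF XH], rule minus_carrier_mat[OF XG], rule minus_carrier_mat[OF XG])
  have X: "X \<in> carrier_mat n n"
    unfolding X' by (rule add_carrier_mat[OF mult_carrier_mat[OF d3 coord_proj_carrier]])
  have "?Lr * ?C * ?JZ = ?P * ((XG - XH) * ?JZ)"
    using assoc_mult_mat[OF P L Cc] assoc_mult_mat[OF P d1 coord_proj_carrier] LC by simp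
  moreover have "?Kr * ?P = ?P * ((XF + XH - XG) * ?J)"
    unfolding coord_proj_def
    using assoc_mult_mat[OF PK Pt P] assoc_mult_mat[OF P K mult_carrier_mat[OF Pt P]] K' by simp
  ultimately have "Y = ?P * ((XG - XH) * ?JZ + (XF + XH - XG) * ?J)"
    unfolding Y_def
    using mult_add_distrib_mat[OF P mult_carrier_mat[OF d1 coord_proj_carrier[of n Z]]
        mult_carrier_mat[OF d2 coord_proj_carrier[of n "Z - S"]]] by simp
  then have YX: "Y = ?P * X"
    unfolding X' using closed_loop_projection(2)[OF Z SZ XG XF XH g0 f0 h0] by simp
  have JX: "?JZ * X = X"
    unfolding X' by (rule closed_loop_projection(1)[OF Z SZ XG XF XH g0 f0 h0])
  have Y: "Y \<in> carrier_mat ?r n" unfolding YX by (rule mult_carrier_mat[OF P X])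
  have AcQ: "Ac * Q = four_block_mat X (0\<^sub>m n ?r) Y (0\<^sub>m ?r ?r)"
    unfolding Ac_def Q_def X_def Y_def
    by (subst mult_four_block_mat[OF XG BMr LrC Kr coord_proj_carrier zero_carrier_mat P zero_carrier_mat])
       (use XG BMr LrC Kr in simp)
  have QAcQ: "Q * (Ac * Q) = Ac * Q"
    unfolding AcQ
    unfolding Q_def
    by (subst mult_four_block_mat[OF coord_proj_carrier zero_carrier_mat P zero_carrier_mat
          X zero_carrier_mat Y zero_carrier_mat])
       (use X Y JX YX in simp)
  have JD: "?JZ * ?D = ?D"
  proof (rule eq_matI)
    fix i j assume "i < dim_row ?D" "j < dim_col ?D"
    then have i: "i < n" and j: "j < card D" by auto
    show "(?JZ * ?D) $$ (i, j) = ?D $$ (i, j)"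
      unfolding coord_proj_mult_index[OF Z basis_mat_carrier i j] basis_mat_index[OF D i j]
      using sorted_nodes(1)[OF D j] DS SZ by auto
  qed auto
  have PD: "?P * ?D = 0\<^sub>m ?r (card D)"
    using basis_mat_orthogonal[OF W D] DS by blast
  have QD: "Q * Dc = Dc"
    unfolding Q_def Dc_def
    by (subst mult_four_block_mat[OF coord_proj_carrier zero_carrier_mat P zero_carrier_mat
          basis_mat_carrier zero_carrier_mat zero_carrier_mat zero_carrier_mat])
       (simp add: JD PD)
  have TJ: "?T * ?JZ = 0\<^sub>m (card T) n"
  proof (rule eq_matI)
    fix k j assume "k < dim_row (0\<^sub>m (card T) n)" "j < dim_col (0\<^sub>m (card T) n)"
    then have k: "k < card T" and j: "j < n" by auto
    have Tc: "?T \<in> carrier_mat (card T) n" by simp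
    show "(?T * ?JZ) $$ (k, j) = 0\<^sub>m (card T) n $$ (k, j)"
      unfolding mult_coord_proj_index[OF Z Tc k j]
      using k j basis_mat_index[OF T j k] sorted_nodes(1)[OF T k] ZT by auto
  qed auto
  have Tcar: "?T \<in> carrier_mat (card T) n" by simp
  have TQ: "Tc * Q = 0\<^sub>m (card T) (n + ?r)"
    unfolding Q_def Tc_def
    by (subst mult_four_block_mat[OF Tcar zero_carrier_mat zero_carrier_mat zero_carrier_mat
          coord_proj_carrier zero_carrier_mat P zero_carrier_mat])
       (simp add: TJ)
  have "rat_mat Tc * resolvent Ac * rat_mat Dc = 0\<^sub>m (card T) (card D)"
  proof (rule transfer_matrix_zero[OF _ _ _ _ QAcQ QD TQ])
    show "Ac \<in> carrier_mat (n + ?r) (n + ?r)" unfolding Ac_def using XG Kr by auto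
    show "Q \<in> carrier_mat (n + ?r) (n + ?r)" unfolding Q_def by auto
    show "Dc \<in> carrier_mat (n + ?r) (card D)"
      unfolding Dc_def carrier_mat_def by simp
    show "Tc \<in> carrier_mat (card T) (n + ?r)"
      unfolding Tc_def carrier_mat_def by simp
  qed
  then have "solves_DDPDF n A B C D T R"
    unfolding Rq solves_DDPDF_def Let_def Ac_def Dc_def Tc_def XG_def append_rows_def by simp
  with order show ?thesis by blast
qed

section \<open>Parametrization of the compensator gains\<close>

lemma mat_eq_add_iff:
  fixes X Y V :: "real mat"
  assumes "X \<in> carrier_mat m k" "Y \<in> carrier_mat m k" "V \<in> carrier_mat m k"
  shows "X = Y + V \<longleftrightarrow> X - Y = V"
proof -
  have "X = Y + V" if "X - Y = V" unfolding that[symmetric] using assms by (intro eq_matI) auto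
  moreover have "X - Y = V" if "X = Y + V" unfolding that using assms by (intro eq_matI) auto
  ultimately show ?thesis by blast
qed

text \<open>The common core of the conditions on \<open>F\<close> and on \<open>G\<close>. Outside \<open>Z\<close> the columns of \<open>A\<close> belonging to
  \<open>V\<close> can be nonzero only in the rows of \<open>B\<close>. As \<open>B\<close> avoids \<open>Z\<close>, all these rows have to be cancelled,
  and row number \<open>k\<close> of \<open>F\<close> acts on exactly one of them.\<close>

lemma input_cancels_iff:
  assumes A: "A \<in> carrier_mat n n" and B: "B \<subseteq> {..<n}" and V: "V \<subseteq> {..<n}" and BZ: "B \<inter> Z = {}"
    and F: "F \<in> carrier_mat (card B) n"
    and out: "\<And>i j. i \<in> V \<Longrightarrow> j < n \<Longrightarrow> j \<notin> Z \<union> B \<Longrightarrow> A $$ (j, i) = 0"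
  shows "(\<forall>i\<in>V. \<forall>j<n. j \<notin> Z \<longrightarrow> (A - basis_mat n B * F) $$ (j, i) = 0) \<longleftrightarrow>
    (\<forall>i\<in>V. \<forall>k<card B. F $$ (k, i) = (transpose_mat (basis_mat n B) * A) $$ (k, i))"
    (is "?l \<longleftrightarrow> ?r")
proof
  assume l: ?l
  show ?r
  proof (intro ballI allI impI)
    fix i k assume i: "i \<in> V" and k: "k < card B"
    then have i': "i < n" using V by auto
    let ?j = "sorted_list_of_set B ! k"
    have j: "?j \<in> B" "?j < n" using sorted_nodes[OF B] k by auto
    then have "(A - basis_mat n B * F) $$ (?j, i) = 0" using l i BZ by auto
    then show "F $$ (k, i) = (transpose_mat (basis_mat n B) * A) $$ (k, i)"
      using basis_mat_mult_index(1)[OF B F i' k] basis_mat_transpose_mult_index[OF B A k i']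
        A F i' j by simp
  qed
next
  assume r: ?r
  show ?l
  proof (intro ballI allI impI)
    fix i j assume i: "i \<in> V" and j: "j < n" "j \<notin> Z"
    then have i': "i < n" using V by auto
    have "(basis_mat n B * F) $$ (j, i) = A $$ (j, i)"
    proof (cases "j \<in> B")
      case True
      then obtain k where k: "k < card B" "sorted_list_of_set B ! k = j"
        using sorted_nodes(2)[OF B] by blast
      then show ?thesis
        using basis_mat_mult_index(1)[OF B F i' k(1)] basis_mat_transpose_mult_index[OF B A k(1) i']
          r i by simp
    next
      case False
      then show ?thesis using basis_mat_mult_index(2)[OF B F i' j(1)] out[OF i j(1)] j by simp
    qed
    then show "(A - basis_mat n B * F) $$ (j, i) = 0" using A F i' j by simp
  qed
qed

lemma state_feedback_iff:
  assumes A: "A \<in> carrier_mat n n" and B: "B \<subseteq> {..<n}" and Z: "Z \<subseteq> {..<n}" and BZ: "B \<inter> Z = {}"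
    and F: "F \<in> carrier_mat (card B) n"
    and out: "\<And>i j. i \<in> Z \<Longrightarrow> j < n \<Longrightarrow> j \<notin> Z \<union> B \<Longrightarrow> A $$ (j, i) = 0"
  shows "(\<forall>x\<in>node_space n Z. (A - basis_mat n B * F) *\<^sub>v x \<in> node_space n Z) \<longleftrightarrow>
    (\<exists>N\<in>carrier_mat (card B) (card ({..<n} - Z)).
       F = transpose_mat (basis_mat n B) * A + N * transpose_mat (basis_mat n ({..<n} - Z)))"
proof -
  let ?BA = "transpose_mat (basis_mat n B) * A"
  have BA: "?BA \<in> carrier_mat (card B) n" using A by (auto intro!: mult_carrier_mat[of _ _ n])
  have XF: "A - basis_mat n B * F \<in> carrier_mat n n" using A F by auto
  have Zp: "{..<n} - Z \<subseteq> {..<n}" by blast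
  have d: "F - ?BA \<in> carrier_mat (card B) n" by (rule minus_carrier_mat[OF BA])
  have "(\<forall>x\<in>node_space n Z. (A - basis_mat n B * F) *\<^sub>v x \<in> node_space n Z) \<longleftrightarrow>
      (\<forall>i\<in>Z. \<forall>k<card B. F $$ (k, i) = ?BA $$ (k, i))"
    unfolding maps_node_space_iff[OF Z Z XF] using input_cancels_iff[OF A B Z BZ F out] by blast
  also have "\<dots> \<longleftrightarrow> (\<forall>k<card B. \<forall>i<n. i \<notin> {..<n} - Z \<longrightarrow> (F - ?BA) $$ (k, i) = 0)"
    using Z F BA by (auto simp del: index_mult_mat)
  also have "\<dots> \<longleftrightarrow> (\<exists>N\<in>carrier_mat (card B) (card ({..<n} - Z)).
      F - ?BA = N * transpose_mat (basis_mat n ({..<n} - Z)))"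
    using basis_mat_transpose_factor_iff[OF Zp d] by blast
  also have "\<dots> \<longleftrightarrow> (\<exists>N\<in>carrier_mat (card B) (card ({..<n} - Z)).
      F = ?BA + N * transpose_mat (basis_mat n ({..<n} - Z)))"
    by (intro bex_cong refl mat_eq_add_iff[OF F BA, symmetric]) auto
  finally show ?thesis .
qed

text \<open>Dual to the state feedback: the columns of \<open>A\<close> that leave \<open>S\<close> belong to \<open>C\<close>, and column
  number \<open>l\<close> of \<open>H\<close> acts on exactly one of them. The inclusion \<open>C \<subseteq> S\<close> makes every column of \<open>H\<close>
  subject to the condition.\<close>

lemma output_injection_iff:
  assumes A: "A \<in> carrier_mat n n" and S: "S \<subseteq> {..<n}" and CS: "C \<subseteq> S"
    and H: "H \<in> carrier_mat n (card C)"
    and inside: "\<And>i j. i \<in> S - C \<Longrightarrow> j < n \<Longrightarrow> j \<notin> S \<Longrightarrow> A $$ (j, i) = 0"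
  shows "(\<forall>x\<in>node_space n S. (A - H * transpose_mat (basis_mat n C)) *\<^sub>v x \<in> node_space n S) \<longleftrightarrow>
    (\<exists>N\<in>carrier_mat (card S) (card C). H = A * basis_mat n C + basis_mat n S * N)"
proof -
  let ?Ct = "basis_mat n C"
  have C: "C \<subseteq> {..<n}" using CS S by blast
  have AC: "A * ?Ct \<in> carrier_mat n (card C)" using A by auto
  have XH: "A - H * transpose_mat ?Ct \<in> carrier_mat n n" using A H by auto
  have d: "H - A * ?Ct \<in> carrier_mat n (card C)" by (rule minus_carrier_mat[OF AC])
  have entry: "(\<forall>i\<in>S. (A - H * transpose_mat ?Ct) $$ (j, i) = 0) \<longleftrightarrow>
      (\<forall>l<card C. (H - A * ?Ct) $$ (j, l) = 0)" if j: "j < n" "j \<notin> S" for j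
  proof
    assume l: "\<forall>i\<in>S. (A - H * transpose_mat ?Ct) $$ (j, i) = 0"
    show "\<forall>l<card C. (H - A * ?Ct) $$ (j, l) = 0"
    proof (intro allI impI)
      fix l assume l': "l < card C"
      let ?i = "sorted_list_of_set C ! l"
      have "?i \<in> S" "?i < n" using sorted_nodes[OF C] l' CS by auto
      then have "(A - H * transpose_mat ?Ct) $$ (j, ?i) = 0" using l by auto
      then show "(H - A * ?Ct) $$ (j, l) = 0"
        using mult_basis_mat_transpose_index(1)[OF C H j(1) l'] mult_basis_mat_index[OF C A j(1) l']
          \<open>?i < n\<close> j H A l' by (simp del: index_mult_mat(1))
    qed
  next
    assume r: "\<forall>l<card C. (H - A * ?Ct) $$ (j, l) = 0"
    show "\<forall>i\<in>S. (A - H * transpose_mat ?Ct) $$ (j, i) = 0"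
    proof
      fix i assume i: "i \<in> S"
      then have i': "i < n" using S by auto
      have "(H * transpose_mat ?Ct) $$ (j, i) = A $$ (j, i)"
      proof (cases "i \<in> C")
        case True
        then obtain l where l: "l < card C" "sorted_list_of_set C ! l = i"
          using sorted_nodes(2)[OF C] by blast
        then have "(H - A * ?Ct) $$ (j, l) = 0" using r by blast
        then show ?thesis
          using mult_basis_mat_transpose_index(1)[OF C H j(1) l(1)]
            mult_basis_mat_index[OF C A j(1) l(1)] l j H A by (simp del: index_mult_mat(1))
      next
        case False
        then show ?thesis
          using mult_basis_mat_transpose_index(2)[OF C H j(1) i'] inside[of i j] i j by simp
      qed
      then show "(A - H * transpose_mat ?Ct) $$ (j, i) = 0"
        using A H i' j by (simp del: index_mult_mat(1))
    qed
  qed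
  have "(\<forall>x\<in>node_space n S. (A - H * transpose_mat ?Ct) *\<^sub>v x \<in> node_space n S) \<longleftrightarrow>
      (\<forall>j<n. \<forall>l<card C. j \<notin> S \<longrightarrow> (H - A * ?Ct) $$ (j, l) = 0)"
    unfolding maps_node_space_iff[OF S S XH] using entry by blast
  also have "\<dots> \<longleftrightarrow> (\<exists>N\<in>carrier_mat (card S) (card C). H - A * ?Ct = basis_mat n S * N)"
    using basis_mat_factor_iff[OF S d] by blast
  also have "\<dots> \<longleftrightarrow> (\<exists>N\<in>carrier_mat (card S) (card C). H = A * ?Ct + basis_mat n S * N)"
    by (intro bex_cong refl mat_eq_add_iff[OF H AC, symmetric]) auto
  finally show ?thesis .
qed

text \<open>The gain \<open>G C\<close> is a state feedback that acts only on the columns of \<open>C\<close>. On the rest of \<open>S\<close> no edge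
  leads out of \<open>S\<close>, hence none out of \<open>Z\<close>, and nothing has to be cancelled; on \<open>C\<close> all entries are
  prescribed. This is why \<open>G\<close> has no free part.\<close>

lemma output_feedback_iff:
  assumes A: "A \<in> carrier_mat n n" and B: "B \<subseteq> {..<n}" and Z: "Z \<subseteq> {..<n}" and SZ: "S \<subseteq> Z"
    and CS: "C \<subseteq> S" and BZ: "B \<inter> Z = {}" and G: "G \<in> carrier_mat (card B) (card C)"
    and out: "\<And>i j. i \<in> Z \<Longrightarrow> j < n \<Longrightarrow> j \<notin> Z \<union> B \<Longrightarrow> A $$ (j, i) = 0"
    and inside: "\<And>i j. i \<in> S - C \<Longrightarrow> j < n \<Longrightarrow> j \<notin> S \<Longrightarrow> A $$ (j, i) = 0"
  shows "(\<forall>x\<in>node_space n S.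
      (A - basis_mat n B * G * transpose_mat (basis_mat n C)) *\<^sub>v x \<in> node_space n Z) \<longleftrightarrow>
    G = transpose_mat (basis_mat n B) * A * basis_mat n C"
proof -
  let ?B = "basis_mat n B" and ?C = "transpose_mat (basis_mat n C)"
  let ?BA = "transpose_mat ?B * A"
  have S: "S \<subseteq> {..<n}" and C: "C \<subseteq> {..<n}" using SZ CS Z by auto
  have BA: "?BA \<in> carrier_mat (card B) n" using A by (auto intro!: mult_carrier_mat[of _ _ n])
  have GC: "G * ?C \<in> carrier_mat (card B) n" using G by auto
  have BGC: "?B * G * ?C = ?B * (G * ?C)" using G by (intro assoc_mult_mat) auto
  have X: "A - ?B * (G * ?C) \<in> carrier_mat n n" using A GC by auto
  have outS: "\<And>i j. i \<in> S \<Longrightarrow> j < n \<Longrightarrow> j \<notin> Z \<union> B \<Longrightarrow> A $$ (j, i) = 0" using out SZ by blast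
  have "(\<forall>x\<in>node_space n S. (A - ?B * G * ?C) *\<^sub>v x \<in> node_space n Z) \<longleftrightarrow>
      (\<forall>i\<in>S. \<forall>k<card B. (G * ?C) $$ (k, i) = ?BA $$ (k, i))"
    unfolding BGC maps_node_space_iff[OF S Z X]
    using input_cancels_iff[OF A B S BZ GC outS] by blast
  also have "\<dots> \<longleftrightarrow> (\<forall>k<card B. \<forall>l<card C. G $$ (k, l) = (?BA * basis_mat n C) $$ (k, l))"
  proof
    assume l: "\<forall>i\<in>S. \<forall>k<card B. (G * ?C) $$ (k, i) = ?BA $$ (k, i)"
    show "\<forall>k<card B. \<forall>l<card C. G $$ (k, l) = (?BA * basis_mat n C) $$ (k, l)"
    proof (intro allI impI)
      fix k l assume kl: "k < card B" "l < card C"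
      then have "sorted_list_of_set C ! l \<in> S" using sorted_nodes(1)[OF C] CS by auto
      then show "G $$ (k, l) = (?BA * basis_mat n C) $$ (k, l)"
        using l kl mult_basis_mat_transpose_index(1)[OF C G kl] mult_basis_mat_index[OF C BA kl]
        by simp
    qed
  next
    assume r: "\<forall>k<card B. \<forall>l<card C. G $$ (k, l) = (?BA * basis_mat n C) $$ (k, l)"
    show "\<forall>i\<in>S. \<forall>k<card B. (G * ?C) $$ (k, i) = ?BA $$ (k, i)"
    proof (intro ballI allI impI)
      fix i k assume i: "i \<in> S" and k: "k < card B"
      then have i': "i < n" using S by auto
      show "(G * ?C) $$ (k, i) = ?BA $$ (k, i)"
      proof (cases "i \<in> C")
        case True
        then obtain l where l: "l < card C" "sorted_list_of_set C ! l = i"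
          using sorted_nodes(2)[OF C] by blast
        then show ?thesis
          using r k mult_basis_mat_transpose_index(1)[OF C G k l(1)] mult_basis_mat_index[OF C BA k l(1)]
          by simp
      next
        case False
        have "sorted_list_of_set B ! k \<notin> S" "sorted_list_of_set B ! k < n"
          using sorted_nodes(1,3)[OF B k] BZ SZ by blast+
        then show ?thesis
          using False i inside mult_basis_mat_transpose_index(2)[OF C G k i']
            basis_mat_transpose_mult_index[OF B A k i'] by simp
      qed
    qed
  qed
  also have "\<dots> \<longleftrightarrow> G = ?BA * basis_mat n C"
    using G BA by (auto intro!: eq_matI simp del: index_mult_mat(1))
  finally show ?thesis .
qed

lemma compensator_gain_formulas:
  fixes A :: "real mat"
  assumes A: "A \<in> carrier_mat n n" and B: "B \<in> carrier_mat n b" and C: "C \<in> carrier_mat c n"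
    and Fq: "Fq \<in> carrier_mat b n" and Hq: "Hq \<in> carrier_mat n c"
    and Bt: "Bt \<in> carrier_mat b n" and Ct: "Ct \<in> carrier_mat n c"
    and F: "F = Bt * A + Fq" and H: "H = A * Ct + Hq" and G: "G = Bt * A * Ct"
  shows "A - B * F - H * C + B * G * C =
      A - B * Bt * A - A * Ct * C + B * Bt * A * Ct * C - (B * Fq + Hq * C)"
    and "H - B * G = A * Ct - B * Bt * A * Ct + Hq"
    and "F - G * C = Bt * A - Bt * A * Ct * C + Fq"
proof -
  have BtA: "Bt * A \<in> carrier_mat b n" and ACt: "A * Ct \<in> carrier_mat n c"
    using A Bt Ct by auto
  have BBt: "B * Bt \<in> carrier_mat n n" and BBtA: "B * Bt * A \<in> carrier_mat n n"
    and BBtAC: "B * Bt * A * Ct \<in> carrier_mat n c" and GC: "Bt * A * Ct * C \<in> carrier_mat b n"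
    and BBtACC: "B * Bt * A * Ct * C \<in> carrier_mat n n" and ACC: "A * Ct * C \<in> carrier_mat n n"
    and BFq: "B * Fq \<in> carrier_mat n n" and HqC: "Hq * C \<in> carrier_mat n n"
    using A B C Bt Ct Fq Hq by auto
  have BF: "B * F = B * Bt * A + B * Fq"
    unfolding F mult_add_distrib_mat[OF B BtA Fq] assoc_mult_mat[OF B Bt A] ..
  have HC: "H * C = A * Ct * C + Hq * C" unfolding H add_mult_distrib_mat[OF ACt Hq C] ..
  have BG: "B * G = B * Bt * A * Ct"
    unfolding G assoc_mult_mat[OF B Bt A] assoc_mult_mat[OF B BtA Ct] ..
  (* Only sums remain to be rearranged, so each product is treated as an opaque matrix. *)
  have regroup: "X1 - (X2 + Y2) - (X3 + Y3) + X4 = X1 - X2 - X3 + X4 - (Y2 + Y3)"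
    if "X1 \<in> carrier_mat n n" "X2 \<in> carrier_mat n n" "X3 \<in> carrier_mat n n" "X4 \<in> carrier_mat n n"
      "Y2 \<in> carrier_mat n n" "Y3 \<in> carrier_mat n n" for X1 X2 X3 X4 Y2 Y3 :: "real mat"
    using that by (intro eq_matI) auto
  have swap: "X + Y - V = X - V + Y"
    if "X \<in> carrier_mat m k" "Y \<in> carrier_mat m k" "V \<in> carrier_mat m k"
    for m k and X Y V :: "real mat"
    using that by (intro eq_matI) auto
  show "A - B * F - H * C + B * G * C =
      A - B * Bt * A - A * Ct * C + B * Bt * A * Ct * C - (B * Fq + Hq * C)"
    unfolding BF HC BG by (rule regroup[OF A BBtA ACC BBtACC BFq HqC])
  show "H - B * G = A * Ct - B * Bt * A * Ct + Hq"
    unfolding BG H by (rule swap[OF ACt Hq BBtAC])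
  show "F - G * C = Bt * A - Bt * A * Ct * C + Fq"
    unfolding F G by (rule swap[OF BtA Fq GC])
qed

lemma reduce_compensator_cancels:
  assumes K: "K \<in> carrier_mat n n" and L: "L \<in> carrier_mat n c" and M: "M \<in> carrier_mat b n"
    and B: "B \<in> carrier_mat n b" and C: "C \<in> carrier_mat c n"
    and Fq: "Fq \<in> carrier_mat b n" and Hq: "Hq \<in> carrier_mat n c"
    and P: "P \<in> carrier_mat r n"
    and FP: "Fq * transpose_mat P = 0\<^sub>m b r" and PH: "P * Hq = 0\<^sub>m r c"
  shows "reduce_compensator P (K - (B * Fq + Hq * C), L + Hq, M + Fq, G) =
    reduce_compensator P (K, L, M, G)"
proof -
  let ?Pt = "transpose_mat P"
  have Pt: "?Pt \<in> carrier_mat n r" using P by simp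
  have BF: "B * Fq \<in> carrier_mat n n" and HC: "Hq * C \<in> carrier_mat n n"
    and PBF: "P * (B * Fq) \<in> carrier_mat r n" and PB: "P * B \<in> carrier_mat r b"
    and PK: "P * K \<in> carrier_mat r n" and PKP: "P * K * ?Pt \<in> carrier_mat r r"
    using P B C Fq Hq K Pt by auto
  have "P * (B * Fq + Hq * C) = P * (B * Fq)"
    using mult_add_distrib_mat[OF P BF HC] assoc_mult_mat[OF P Hq C, symmetric]
      left_mult_zero_mat[OF C, of r] PH PBF by (metis right_add_zero_mat)
  moreover have "P * (B * Fq) * ?Pt = 0\<^sub>m r r"
    using assoc_mult_mat[OF P B Fq] assoc_mult_mat[OF PB Fq Pt] FP right_mult_zero_mat[OF PB, of r] by simp
  ultimately have "P * (K - (B * Fq + Hq * C)) * ?Pt = P * K * ?Pt - 0\<^sub>m r r"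
    using mult_minus_distrib_mat[OF P K add_carrier_mat[OF HC, of "B * Fq"]]
      minus_mult_distrib_mat[OF PK PBF Pt] by simp
  also have "\<dots> = P * K * ?Pt" using PKP by (intro eq_matI) auto
  finally have "P * (K - (B * Fq + Hq * C)) * ?Pt = P * K * ?Pt" .
  moreover have "P * (L + Hq) = P * L"
    using mult_add_distrib_mat[OF P L Hq] PH mult_carrier_mat[OF P L] by simp
  moreover have "(M + Fq) * ?Pt = M * ?Pt"
    using add_mult_distrib_mat[OF M Fq Pt] FP mult_carrier_mat[OF M Pt] by simp
  ultimately show ?thesis by simp
qed

theorem theorem12:
  fixes n :: nat and E :: "(nat \<times> nat) set" and A :: "real mat" and B C D T :: "nat set"
  assumes "weighted_digraph n E A"
    and "B \<subseteq> {..<n}" "C \<subseteq> {..<n}" "D \<subseteq> {..<n}" "T \<subseteq> {..<n}"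
    and "D \<inter> T = {}" "D \<inter> B = {}" "T \<inter> C = {}"
    and "CAB_pair n C A B (S_circ E D C) (Z_circ n E T B)"
    and "C = in_boundary E (S_circ E D C)"
    and "B = out_boundary E (Z_circ n E T B)"
  shows "let S = S_circ E D C; Z = Z_circ n E T B;
             Bm = basis_mat n B; Bt = transpose_mat Bm;
             Ct = basis_mat n C; Cm = transpose_mat Ct;
             Sm = basis_mat n S; Zperp = basis_mat n ({..<n} - Z)
         in full_order_compensators n A B C S Z =
              {(K, L, M, G) | K L M G.
                 \<exists>N1 \<in> carrier_mat (card B) (card ({..<n} - Z)).
                 \<exists>N2 \<in> carrier_mat (card S) (card C).
                   let Fq = N1 * transpose_mat Zperp; Hq = Sm * N2; Kq = Bm * Fq + Hq * Cm
                   in K = A - Bm * Bt * A - A * Ct * Cm + Bm * Bt * A * Ct * Cm - Kq \<and>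
                      L = A * Ct - Bm * Bt * A * Ct + Hq \<and>
                      M = Bt * A - Bt * A * Ct * Cm + Fq \<and>
                      G = Bt * A * Ct} \<and>
            (\<exists>R. reduced_order_compensators n A B C S Z = {R} \<and>
                 compensator_of_order (card Z - card S) B C R \<and>
                 solves_DDPDF n A B C D T R)"
proof -
  define S where "S = S_circ E D C"
  define Z where "Z = Z_circ n E T B"
  let ?B = "basis_mat n B" and ?Ct = "basis_mat n C" and ?Sm = "basis_mat n S"
  let ?Zp = "basis_mat n ({..<n} - Z)" and ?P = "transpose_mat (basis_mat n (Z - S))"
  let ?Bt = "transpose_mat ?B" and ?C = "transpose_mat ?Ct"
  let ?K = "A - ?B * ?Bt * A - A * ?Ct * ?C + ?B * ?Bt * A * ?Ct * ?C"
  let ?L = "A * ?Ct - ?B * ?Bt * A * ?Ct" and ?M = "?Bt * A - ?Bt * A * ?Ct * ?C"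
  let ?G = "?Bt * A * ?Ct"
  let ?k = "\<lambda>N1 N2. (?K - (?B * (N1 * transpose_mat ?Zp) + ?Sm * N2 * ?C), ?L + ?Sm * N2,
    ?M + N1 * transpose_mat ?Zp, ?G)"
  let ?c1 = "carrier_mat (card B) (card ({..<n} - Z)) :: real mat set"
  let ?c2 = "carrier_mat (card S) (card C) :: real mat set"
  have A: "A \<in> carrier_mat n n" using assms(1) by (simp add: weighted_digraph_def)
  note pair = assms(9)[folded S_def Z_def, unfolded CAB_pair_def]
  have S: "S \<subseteq> {..<n}" and Z: "Z \<subseteq> {..<n}" and SZ: "S \<subseteq> Z" using pair by auto
  have CS: "C \<subseteq> S" using assms(10) unfolding S_def[symmetric] in_boundary_def by blast
  have BZ: "B \<inter> Z = {}" using assms(11) unfolding Z_def[symmetric] out_boundary_def by blast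
  have entry: "A $$ (j, i) = 0" if "(i, j) \<notin> E" "i < n" "j < n" for i j
    using assms(1) that unfolding weighted_digraph_def by blast
  have out: "A $$ (j, i) = 0" if "i \<in> Z" "j < n" "j \<notin> Z \<union> B" for i j
    using pair AB_invariant_iff[OF assms(1,2) Z] that Z by (intro entry) auto
  have inside: "A $$ (j, i) = 0" if "i \<in> S - C" "j < n" "j \<notin> S" for i j
    using pair CA_invariant_iff[OF assms(1) S] that S by (intro entry) auto
  have Bc: "?B \<in> carrier_mat n (card B)" and Cc: "?C \<in> carrier_mat (card C) n"
    and Btc: "?Bt \<in> carrier_mat (card B) n" and Ctc: "?Ct \<in> carrier_mat n (card C)"
    by auto
  have Fqc: "N1 * transpose_mat ?Zp \<in> carrier_mat (card B) n" if "N1 \<in> ?c1" for N1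
    using that by (intro mult_carrier_mat) auto
  have Hqc: "?Sm * N2 \<in> carrier_mat n (card C)" if "N2 \<in> ?c2" for N2
    using that by (intro mult_carrier_mat) auto
  have BtA: "?Bt * A \<in> carrier_mat (card B) n" and ACt: "A * ?Ct \<in> carrier_mat n (card C)"
    by (rule mult_carrier_mat[OF Btc A], rule mult_carrier_mat[OF A Ctc])
  have Gc: "?G \<in> carrier_mat (card B) (card C)" by (rule mult_carrier_mat[OF BtA Ctc])
  note F_iff = state_feedback_iff[OF A assms(2) Z BZ _ out]
  note H_iff = output_injection_iff[OF A S CS _ inside]
  note G_iff = output_feedback_iff[OF A assms(2) Z SZ CS BZ _ out inside]
  have full: "full_order_compensators n A B C S Z = {?k N1 N2 | N1 N2. N1 \<in> ?c1 \<and> N2 \<in> ?c2}"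
  proof (intro equalityI subsetI)
    fix R assume "R \<in> full_order_compensators n A B C S Z"
    then obtain F G H where F: "F \<in> carrier_mat (card B) n"
      and G: "G \<in> carrier_mat (card B) (card C)" and H: "H \<in> carrier_mat n (card C)"
      and conds: "\<forall>x\<in>node_space n S. (A - ?B * G * ?C) *\<^sub>v x \<in> node_space n Z"
        "\<forall>x\<in>node_space n Z. (A - ?B * F) *\<^sub>v x \<in> node_space n Z"
        "\<forall>x\<in>node_space n S. (A - H * ?C) *\<^sub>v x \<in> node_space n S"
      and R: "R = (A - ?B * F - H * ?C + ?B * G * ?C, H - ?B * G, F - G * ?C, G)"
      unfolding full_order_compensators_def Let_def by blast
    have Geq: "G = ?G" using G_iff[OF G] conds(1) by blast
    obtain N1 where N1: "N1 \<in> ?c1" and Feq: "F = ?Bt * A + N1 * transpose_mat ?Zp"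
      using F_iff[OF F] conds(2) by blast
    obtain N2 where N2: "N2 \<in> ?c2" and Heq: "H = A * ?Ct + ?Sm * N2"
      using H_iff[OF H] conds(3) by blast
    have "R = ?k N1 N2"
      unfolding R compensator_gain_formulas[OF A Bc Cc Fqc[OF N1] Hqc[OF N2] Btc Ctc Feq Heq Geq]
      unfolding Geq ..
    then show "R \<in> {?k N1 N2 | N1 N2. N1 \<in> ?c1 \<and> N2 \<in> ?c2}" using N1 N2 by blast
  next
    fix R assume "R \<in> {?k N1 N2 | N1 N2. N1 \<in> ?c1 \<and> N2 \<in> ?c2}"
    then obtain N1 N2 where N1: "N1 \<in> ?c1" and N2: "N2 \<in> ?c2" and R: "R = ?k N1 N2" by blast
    define F where "F = ?Bt * A + N1 * transpose_mat ?Zp"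
    define H where "H = A * ?Ct + ?Sm * N2"
    have F: "F \<in> carrier_mat (card B) n" unfolding F_def by (rule add_carrier_mat[OF Fqc[OF N1]])
    have H: "H \<in> carrier_mat n (card C)" unfolding H_def by (rule add_carrier_mat[OF Hqc[OF N2]])
    have "R = (A - ?B * F - H * ?C + ?B * ?G * ?C, H - ?B * ?G, F - ?G * ?C, ?G)"
      unfolding R compensator_gain_formulas[OF A Bc Cc Fqc[OF N1] Hqc[OF N2] Btc Ctc F_def H_def refl] ..
    moreover have "\<forall>x\<in>node_space n S. (A - ?B * ?G * ?C) *\<^sub>v x \<in> node_space n Z"
      using G_iff[OF Gc] by blast
    moreover have "\<forall>x\<in>node_space n Z. (A - ?B * F) *\<^sub>v x \<in> node_space n Z"
      using F_iff[OF F] N1 F_def by blast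
    moreover have "\<forall>x\<in>node_space n S. (A - H * ?C) *\<^sub>v x \<in> node_space n S"
      using H_iff[OF H] N2 H_def by blast
    ultimately show "R \<in> full_order_compensators n A B C S Z"
      unfolding full_order_compensators_def Let_def using F H Gc by blast
  qed
  let ?R = "reduce_compensator ?P (?K, ?L, ?M, ?G)"
  have reduced: "reduced_order_compensators n A B C S Z = {?R}"
  proof -
    have W: "Z - S \<subseteq> {..<n}" and Zp: "{..<n} - Z \<subseteq> {..<n}" using Z by auto
    have P: "?P \<in> carrier_mat (card (Z - S)) n" by simp
    have BBtACC: "?B * ?Bt * A * ?Ct * ?C \<in> carrier_mat n n"
      and BBtAC: "?B * ?Bt * A * ?Ct \<in> carrier_mat n (card C)"
      and GC: "?G * ?C \<in> carrier_mat (card B) n"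
      using A by (auto intro!: mult_carrier_mat)
    have K: "?K \<in> carrier_mat n n" by (rule add_carrier_mat[OF BBtACC])
    have L: "?L \<in> carrier_mat n (card C)" by (rule minus_carrier_mat[OF BBtAC])
    have M: "?M \<in> carrier_mat (card B) n" by (rule minus_carrier_mat[OF GC])
    have const: "reduce_compensator ?P (?k N1 N2) = ?R" if N1: "N1 \<in> ?c1" and N2: "N2 \<in> ?c2" for N1 N2
    proof (rule reduce_compensator_cancels[OF K L M Bc Cc Fqc[OF N1] Hqc[OF N2] P])
      have "transpose_mat ?Zp * basis_mat n (Z - S) = 0\<^sub>m (card ({..<n} - Z)) (card (Z - S))"
        by (rule basis_mat_orthogonal[OF Zp W]) blast
      moreover have "N1 * transpose_mat ?Zp * basis_mat n (Z - S) =
          N1 * (transpose_mat ?Zp * basis_mat n (Z - S))"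
        using N1 by (intro assoc_mult_mat) auto
      ultimately show "N1 * transpose_mat ?Zp * transpose_mat ?P = 0\<^sub>m (card B) (card (Z - S))"
        using right_mult_zero_mat[OF N1] by simp
      have "?P * ?Sm = 0\<^sub>m (card (Z - S)) (card S)"
        by (rule basis_mat_orthogonal[OF W S]) blast
      moreover have "?P * (?Sm * N2) = ?P * ?Sm * N2"
        using N2 by (intro assoc_mult_mat[symmetric]) auto
      ultimately show "?P * (?Sm * N2) = 0\<^sub>m (card (Z - S)) (card C)"
        using left_mult_zero_mat[OF N2] by simp
    qed
    have "?k (0\<^sub>m (card B) (card ({..<n} - Z))) (0\<^sub>m (card S) (card C)) \<in> full_order_compensators n A B C S Z"
      unfolding full using zero_carrier_mat by blast
    from imageI[OF this, of "reduce_compensator ?P"]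
    have "?R \<in> reduced_order_compensators n A B C S Z"
      unfolding reduced_order_compensators_def const[OF zero_carrier_mat zero_carrier_mat] .
    moreover have "reduced_order_compensators n A B C S Z \<subseteq> {?R}"
      unfolding reduced_order_compensators_def full using const by blast
    ultimately show ?thesis by blast
  qed
  have DS: "D \<subseteq> S" unfolding S_def by (rule S_circ_least(1)[OF assms(1,4)])
  have ZT: "Z \<inter> T = {}" using Z_circ_greatest(1)[OF assms(1,2), of T] unfolding Z_def by blast
  have solves: "compensator_of_order (card Z - card S) B C ?R \<and> solves_DDPDF n A B C D T ?R"
    using reduced_compensator_decouples[OF A assms(2,3,5) Z SZ DS ZT] reduced by blast
  show ?thesis
    unfolding Let_def S_def[symmetric] Z_def[symmetric] using full reduced solves by blast
qed

end
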